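(* In the Euclidean plane or space, let ${\rm O},{\rm A},{\rm B}$ be three distinct points such that ${\rm O}$ does not lie on the segment ${\rm A}{\rm B}$. For every $T>0$ there is a unique direct Keplerian arc around ${\rm O}$ and a unique simple indirect Keplerian arc around ${\rm O}$ going from ${\rm A}$ to ${\rm B}$ with elapsed time $T$.
   Context: Kepler problem normalized as $\ddot q=-q/|q|^3$, fixed center ${\rm O}$. A Keplerian arc from ${\rm A}$ to ${\rm B}$ is a solution on a compact time interval $[t_{\rm A},t_{\rm B}]$, $t_{\rm A}<t_{\rm B}$, with $q(t_{\rm A})={\rm A}$, $q(t_{\rm B})={\rm B}$; elapsed time $t_{\rm B}-t_{\rm A}$. Rectilinear motions are extended after collision with ${\rm O}$ (bounce back along the same ray with the same energy). An arc is indirect if its convex hull contains ${\rm O}$, direct otherwise. An indirect arc is multi-revolution if the orbit is periodic and the elapsed time exceeds a period, and simple otherwise. *)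

theory Defs
  imports "HOL-Analysis.Analysis"
begin

text \<open>Kepler problem with fixed centre c (normalised: q'' = -(q-c)/|q-c|^3).
A Keplerian arc on [t0,t1] is a continuous curve q with finitely many collision
times (q t = c); away from collisions it is a classical solution with velocity v;
the energy |v|^2/2 - 1/|q-c| is one constant on all non-collision times (same energy
after a bounce), and near each collision time the motion stays on one ray from c
(bounce back along the same ray).\<close>

definition kepler_arc :: "'a::euclidean_space \<Rightarrow> (real \<Rightarrow> 'a) \<Rightarrow> real \<Rightarrow> real \<Rightarrow> bool" where
  "kepler_arc c q t0 t1 \<longleftrightarrow>
     t0 < t1 \<and> continuous_on {t0..t1} q \<and> finite {t\<in>{t0..t1}. q t = c} \<and>
     (\<exists>v E. \<forall>t\<in>{t0..t1}. q t \<noteq> c \<longrightarrow>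
          (q has_vector_derivative v t) (at t within {t0..t1}) \<and>
          (v has_vector_derivative (- (1 / norm (q t - c) ^ 3)) *\<^sub>R (q t - c)) (at t within {t0..t1}) \<and>
          norm (v t) ^ 2 / 2 - 1 / norm (q t - c) = E) \<and>
     (\<forall>s\<in>{t0..t1}. q s = c \<longrightarrow>
        (\<exists>u e. e > 0 \<and> (\<forall>t\<in>{t0..t1}. \<bar>t - s\<bar> < e \<longrightarrow> (\<exists>r\<ge>0. q t = c + r *\<^sub>R u))))"

definition kepler_arc_from_to :: "'a::euclidean_space \<Rightarrow> (real \<Rightarrow> 'a) \<Rightarrow> real \<Rightarrow> real \<Rightarrow> 'a \<Rightarrow> 'a \<Rightarrow> bool" where
  "kepler_arc_from_to c q t0 t1 A B \<longleftrightarrow> kepler_arc c q t0 t1 \<and> q t0 = A \<and> q t1 = B"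

definition indirect_arc :: "'a::euclidean_space \<Rightarrow> (real \<Rightarrow> 'a) \<Rightarrow> real \<Rightarrow> real \<Rightarrow> bool" where
  "indirect_arc c q t0 t1 \<longleftrightarrow> c \<in> convex hull (q ` {t0..t1})"

definition direct_arc :: "'a::euclidean_space \<Rightarrow> (real \<Rightarrow> 'a) \<Rightarrow> real \<Rightarrow> real \<Rightarrow> bool" where
  "direct_arc c q t0 t1 \<longleftrightarrow> \<not> indirect_arc c q t0 t1"

definition multi_revolution :: "'a::euclidean_space \<Rightarrow> (real \<Rightarrow> 'a) \<Rightarrow> real \<Rightarrow> real \<Rightarrow> bool" where
  "multi_revolution c q t0 t1 \<longleftrightarrow> indirect_arc c q t0 t1 \<and>
     (\<exists>P>0. P < t1 - t0 \<and> (\<forall>t\<in>{t0..t1 - P}. q (t + P) = q t))"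

definition simple_indirect_arc :: "'a::euclidean_space \<Rightarrow> (real \<Rightarrow> 'a) \<Rightarrow> real \<Rightarrow> real \<Rightarrow> bool" where
  "simple_indirect_arc c q t0 t1 \<longleftrightarrow> indirect_arc c q t0 t1 \<and> \<not> multi_revolution c q t0 t1"

definition unique_curve_on :: "real set \<Rightarrow> ((real \<Rightarrow> 'a) \<Rightarrow> bool) \<Rightarrow> bool" where
  "unique_curve_on S P \<longleftrightarrow> (\<exists>q. P q \<and> (\<forall>q'. P q' \<longrightarrow> (\<forall>t\<in>S. q' t = q t)))"

end

theory Submission
  imports Defs
begin

text \<open>
  Write \<open>q = z\<^sup>2\<close> (Levi-Civita). In the time \<open>s\<close> with \<open>ds = dt / |q|\<close> the point \<open>z\<close> is a linear oscillator
  \<open>z'' = (E / 2) z\<close>, also through collisions, so an arc that makes less than one turn is fixed by the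
  end values \<open>\<alpha>\<close>, \<open>\<beta>\<close> of \<open>z\<close> and the number \<open>c = cos (\<omega> S)\<close>, where \<open>S\<close> is the length of the \<open>s\<close>-interval (with \<open>cosh\<close> for
  positive energy). The endpoints determine \<open>\<alpha>\<close>, \<open>\<beta>\<close> up to sign; the sign of \<open>p = \<langle>\<alpha>, \<beta>\<rangle>\<close> decides
  between direct (\<open>p > 0\<close>) and indirect (\<open>p < 0\<close>). In the parameter \<open>x = sin (\<omega> s) / (sin (\<omega> s) + sin (\<omega> (S - s)))\<close>
  the arc is rational, uniformly in the energy:
  \<open>q = ((1 - x) \<alpha> + x \<beta>)\<^sup>2 / D\<close> with \<open>D = (1 - x)\<^sup>2 + x\<^sup>2 + 2 c x (1 - x)\<close>, and
  \<open>dt = sqrt (2 w) |(1 - x) \<alpha> + x \<beta>|\<^sup>2 / D\<^sup>2 dx\<close> with \<open>w = |A| + |B| - 2 p c\<close>.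
  The elapsed time is therefore an explicit function of \<open>c\<close>, and the theorem follows because this
  function decreases strictly from infinity to 0.
\<close>

section \<open>The transfer time as a function of \<open>c\<close>\<close>

text \<open>The energy would not do as parameter: \<open>E * w = c\<^sup>2 - 1\<close> can have two
  roots \<open>c\<close> in (-1, 1), two arcs of ellipses with the same major axis, so the time is
  not a function of \<open>E\<close>; in \<open>c\<close> it is single-valued and monotone. For
  \<open>p > 0\<close> monotonicity is cheap. For \<open>p < 0\<close> the square root in
  \<open>lambertT\<close> grows with \<open>c\<close>, and a bound on \<open>lambertF\<close> with
  equality at the parabolic value \<open>c = 1\<close> is needed to beat it.

  Two more obstacles shape the second half. In space there is no complex multiplication, so only
  quadratic expressions in \<open>z\<close> and \<open>z'\<close> are used, each rewritten as a
  vector or scalar of the original space. And the differential equation does not connect the two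
  sides of a collision. The common energy and the common ray do: they make the Laplace vector
  constant over the whole arc, and only then does a single oscillator describe it.\<close>

definition lambert_den :: "real \<Rightarrow> real \<Rightarrow> real" where
  "lambert_den c x = (1 - x)\<^sup>2 + x\<^sup>2 + 2 * c * x * (1 - x)"

lemma lambert_den_pos:
  assumes "c > -1" "x \<in> {0..1}" shows "lambert_den c x > 0"
proof (cases "x = 0 \<or> x = 1")
  case False
  then have "x * (1 - x) > 0" using assms by simp
  then have "(1 + c) * (x * (1 - x)) > 0" using assms by simp
  moreover have "lambert_den c x = (1 - 2 * x)\<^sup>2 + 2 * ((1 + c) * (x * (1 - x)))"
    by (simp add: lambert_den_def power2_eq_square algebra_simps)
  ultimately show ?thesis by (simp add: add_nonneg_pos)
qed (auto simp: lambert_den_def)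

lemma lambert_den_has_derivative [derivative_intros]:
  "((\<lambda>x. lambert_den c x) has_real_derivative 2 * (1 - c) * (2 * x - 1)) (at x within S)"
  unfolding lambert_den_def by (auto intro!: derivative_eq_intros simp: algebra_simps)

lemma DERIV_divide_square:
  fixes f g :: "real \<Rightarrow> real"
  assumes "(f has_real_derivative f') (at x within S)" "(g has_real_derivative g') (at x within S)" "g x \<noteq> 0"
  shows "((\<lambda>x. f x / (g x)\<^sup>2) has_real_derivative (f' * g x - 2 * f x * g') / (g x) ^ 3) (at x within S)"
proof (rule DERIV_cong[OF DERIV_divide[OF assms(1) DERIV_power[OF assms(2), of 2]]])
  show "(f' * (g x)\<^sup>2 - f x * (of_nat 2 * (g' * g x ^ (2 - Suc 0)))) / ((g x)\<^sup>2 * (g x)\<^sup>2)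
    = (f' * g x - 2 * f x * g') / (g x) ^ 3"
    using assms(3) by (simp add: divide_simps) algebra
qed (use assms(3) in simp)

lemma continuous_on_lambert_den [continuous_intros]: "continuous_on S (\<lambda>x. lambert_den c x)"
  unfolding lambert_den_def by (intro continuous_intros)

text \<open>For \<open>c = cos \<theta>\<close> with \<open>0 < \<theta> < pi\<close> this is
  \<open>(\<theta> - sin \<theta> * cos \<theta>) / sin \<theta> ^ 3\<close>. The integral form is
  smooth across \<open>c = 1\<close>, so elliptic, parabolic and hyperbolic arcs share one
  formula.\<close>

definition lambertF :: "real \<Rightarrow> real" where
  "lambertF c = integral {0..1} (\<lambda>x. 2 * (1 - x)\<^sup>2 / (lambert_den c x)\<^sup>2)"

definition lambertG :: "real \<Rightarrow> real" where
  "lambertG c = integral {0..1} (\<lambda>x. 2 * (x * (1 - x)) / (lambert_den c x)\<^sup>2)"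

lemma integrable_over_lambert_den:
  assumes "c > -1" "continuous_on {0..1} f"
  shows "(\<lambda>x. f x / (lambert_den c x) ^ n) integrable_on {0..1}"
  using lambert_den_pos[OF assms(1)]
  by (intro integrable_continuous_interval continuous_intros assms(2)) force

text \<open>An antiderivative is \<open>- ((1 - x)\<^sup>2 / lambert_den c x)\<close>. The relation
  eliminates \<open>lambertG\<close> from the transfer time and leaves one transcendental
  function.\<close>

lemma lambertF_plus_G:
  assumes c: "c > -1" shows "c * lambertF c + lambertG c = 1"
proof -
  have D: "lambert_den c x \<noteq> 0" if "x \<in> {0..1}" for x using lambert_den_pos[OF c that] by simp
  have "((\<lambda>x. c * (2 * (1 - x)\<^sup>2 / (lambert_den c x)\<^sup>2) + 2 * (x * (1 - x)) / (lambert_den c x)\<^sup>2) has_integral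
        (- ((1 - 1)\<^sup>2 / lambert_den c 1)) - (- ((1 - 0)\<^sup>2 / lambert_den c 0))) {0..1}"
  proof (rule fundamental_theorem_of_calculus)
    fix x :: real assume x: "x \<in> {0..1}"
    have "((\<lambda>x. - ((1 - x)\<^sup>2 / lambert_den c x)) has_real_derivative
       - ((- 2 * (1 - x)) * lambert_den c x - (1 - x)\<^sup>2 * (2 * (1 - c) * (2 * x - 1))) / (lambert_den c x)\<^sup>2) (at x within {0..1})"
      using D[OF x] by (auto intro!: derivative_eq_intros simp: power2_eq_square field_simps)
    moreover have "- ((- 2 * (1 - x)) * lambert_den c x - (1 - x)\<^sup>2 * (2 * (1 - c) * (2 * x - 1)))
        = c * (2 * (1 - x)\<^sup>2) + 2 * (x * (1 - x))"
      unfolding lambert_den_def by algebra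
    ultimately show "((\<lambda>x. - ((1 - x)\<^sup>2 / lambert_den c x)) has_vector_derivative
       c * (2 * (1 - x)\<^sup>2 / (lambert_den c x)\<^sup>2) + 2 * (x * (1 - x)) / (lambert_den c x)\<^sup>2) (at x within {0..1})"
      by (simp only: has_real_derivative_iff_has_vector_derivative add_divide_distrib[symmetric] times_divide_eq_right)
  qed simp
  moreover have "((\<lambda>x. c * (2 * (1 - x)\<^sup>2 / (lambert_den c x)\<^sup>2) + 2 * (x * (1 - x)) / (lambert_den c x)\<^sup>2) has_integral
        c * lambertF c + lambertG c) {0..1}"
    unfolding lambertF_def lambertG_def
    by (intro has_integral_add has_integral_mult_right integrable_integral integrable_over_lambert_den c continuous_intros)
  ultimately have "c * lambertF c + lambertG c = (- ((1 - 1)\<^sup>2 / lambert_den c 1)) - (- ((1 - 0)\<^sup>2 / lambert_den c 0))"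
    by (rule has_integral_unique[rotated])
  then show ?thesis by (simp add: lambert_den_def)
qed

text \<open>The symmetry between \<open>x\<close> and \<open>1 - x\<close>, proved by an explicit
  antiderivative of the difference of the two integrands that vanishes at both ends.\<close>

lemma lambertF_reflect:
  assumes c: "c > -1" shows "((\<lambda>x. 2 * x\<^sup>2 / (lambert_den c x)\<^sup>2) has_integral lambertF c) {0..1}"
proof -
  have D: "lambert_den c x \<noteq> 0" if "x \<in> {0..1}" for x using lambert_den_pos[OF c that] by simp
  have "((\<lambda>x. 2 * (1 - x)\<^sup>2 / (lambert_den c x)\<^sup>2 - 2 * x\<^sup>2 / (lambert_den c x)\<^sup>2) has_integral
        2 * (1 * (1 - 1)) / lambert_den c 1 - 2 * (0 * (1 - 0)) / lambert_den c 0) {0..1}"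
  proof (rule fundamental_theorem_of_calculus)
    fix x :: real assume x: "x \<in> {0..1}"
    have "((\<lambda>x. 2 * (x * (1 - x)) / lambert_den c x) has_real_derivative
       (2 * (1 - 2 * x) * lambert_den c x - 2 * (x * (1 - x)) * (2 * (1 - c) * (2 * x - 1))) / (lambert_den c x)\<^sup>2) (at x within {0..1})"
      using D[OF x] by (auto intro!: derivative_eq_intros simp: power2_eq_square field_simps)
    moreover have "2 * (1 - 2 * x) * lambert_den c x - 2 * (x * (1 - x)) * (2 * (1 - c) * (2 * x - 1))
        = 2 * (1 - x)\<^sup>2 - 2 * x\<^sup>2"
      unfolding lambert_den_def by algebra
    ultimately show "((\<lambda>x. 2 * (x * (1 - x)) / lambert_den c x) has_vector_derivative
       2 * (1 - x)\<^sup>2 / (lambert_den c x)\<^sup>2 - 2 * x\<^sup>2 / (lambert_den c x)\<^sup>2) (at x within {0..1})"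
      by (simp only: has_real_derivative_iff_has_vector_derivative diff_divide_distrib[symmetric])
  qed simp
  then have 1: "((\<lambda>x. 2 * (1 - x)\<^sup>2 / (lambert_den c x)\<^sup>2 - 2 * x\<^sup>2 / (lambert_den c x)\<^sup>2) has_integral 0) {0..1}" by simp
  have 2: "((\<lambda>x. 2 * (1 - x)\<^sup>2 / (lambert_den c x)\<^sup>2) has_integral lambertF c) {0..1}"
    unfolding lambertF_def by (intro integrable_integral integrable_over_lambert_den c continuous_intros)
  from has_integral_diff[OF 2 1] show ?thesis by simp
qed

lemma lambertF_has_derivative:
  assumes c: "c > -1"
  shows "(lambertF has_real_derivative
           integral {0..1} (\<lambda>x. - (8 * x * (1 - x) ^ 3) / (lambert_den c x) ^ 3)) (at c)"
proof -
  have "(lambertF has_real_derivative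
           integral (cbox 0 1) (\<lambda>x. - (8 * x * (1 - x) ^ 3) / (lambert_den c x) ^ 3)) (at c within {-1<..})"
    unfolding lambertF_def cbox_interval[symmetric]
  proof (rule leibniz_rule_field_derivative)
    fix c x :: real assume c: "c \<in> {-1<..}" and x: "x \<in> cbox 0 1"
    have D: "lambert_den c x \<noteq> 0" using lambert_den_pos[of c x] c x by simp
    have d: "((\<lambda>c. lambert_den c x) has_real_derivative 2 * x * (1 - x)) (at c within {-1<..})"
      unfolding lambert_den_def by (auto intro!: derivative_eq_intros)
    show "((\<lambda>c. 2 * (1 - x)\<^sup>2 / (lambert_den c x)\<^sup>2) has_real_derivative - (8 * x * (1 - x) ^ 3) / (lambert_den c x) ^ 3) (at c within {-1<..})"
      by (rule DERIV_cong[OF DERIV_divide[OF DERIV_const DERIV_power[OF d, of 2]]])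
         (use D in \<open>simp_all add: divide_simps power2_eq_square power3_eq_cube\<close>)
  next
    fix c :: real assume "c \<in> {-1<..}"
    then show "(\<lambda>x. 2 * (1 - x)\<^sup>2 / (lambert_den c x)\<^sup>2) integrable_on cbox 0 1"
      by (auto intro!: integrable_over_lambert_den continuous_intros)
  next
    have "continuous_on ({-1<..} \<times> cbox 0 (1::real)) (\<lambda>(c, x). lambert_den c x)"
      unfolding lambert_den_def case_prod_unfold by (intro continuous_intros)
    then show "continuous_on ({-1<..} \<times> cbox 0 1) (\<lambda>(c, x). - (8 * x * (1 - x) ^ 3) / lambert_den c x ^ 3)"
      unfolding case_prod_unfold
      by (intro continuous_intros) (auto dest!: lambert_den_pos)
  qed (use c in \<open>auto\<close>)
  then show ?thesis using c by (simp add: at_within_open[of c "{-1<..}"])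
qed

text \<open>The antiderivative \<open>?W\<close> turns the derivative under the integral sign into a
  first-order linear equation for \<open>lambertF\<close>. Its leading coefficient vanishes at
  \<open>c = 1\<close>, so the solved form excludes that point.\<close>

lemma lambertF_deriv_eq:
  assumes c: "c > -1"
  shows "(1 - c\<^sup>2) * integral {0..1} (\<lambda>x. - (8 * x * (1 - x) ^ 3) / (lambert_den c x) ^ 3) = 3 * c * lambertF c - 2"
proof -
  have D: "lambert_den c x \<noteq> 0" if "x \<in> {0..1}" for x using lambert_den_pos[OF c that] by simp
  let ?d = "\<lambda>x. (1 - c\<^sup>2) * (- (8 * x * (1 - x) ^ 3) / (lambert_den c x) ^ 3) - 3 * c * (2 * (1 - x)\<^sup>2 / (lambert_den c x)\<^sup>2)"
  let ?W = "\<lambda>x. 2 * ((1 - x) + c * x) * (1 - x) ^ 3 / (lambert_den c x)\<^sup>2"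
  have "(?d has_integral ?W 1 - ?W 0) {0..1}"
  proof (rule fundamental_theorem_of_calculus)
    fix x :: real assume x: "x \<in> {0..1}"
    let ?W' = "2 * (c - 1) * (1 - x) ^ 3 - 6 * ((1 - x) + c * x) * (1 - x)\<^sup>2"
    have num: "((\<lambda>x. 2 * ((1 - x) + c * x) * (1 - x) ^ 3) has_real_derivative ?W') (at x within {0..1})"
      by (auto intro!: derivative_eq_intros simp: algebra_simps)
    have "(?W has_real_derivative
       (?W' * lambert_den c x - 2 * (2 * ((1 - x) + c * x) * (1 - x) ^ 3) * (2 * (1 - c) * (2 * x - 1))) / (lambert_den c x)^3) (at x within {0..1})"
      by (rule DERIV_divide_square[OF num lambert_den_has_derivative D[OF x]])
    moreover have "?W' * lambert_den c x - 2 * (2 * ((1 - x) + c * x) * (1 - x) ^ 3) * (2 * (1 - c) * (2 * x - 1))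
        = (1 - c\<^sup>2) * (- (8 * x * (1 - x) ^ 3)) - 3 * c * (2 * (1 - x)\<^sup>2) * lambert_den c x"
      unfolding lambert_den_def by algebra
    moreover have "((1 - c\<^sup>2) * (- (8 * x * (1 - x) ^ 3)) - 3 * c * (2 * (1 - x)\<^sup>2) * lambert_den c x) / (lambert_den c x)^3 = ?d x"
      using D[OF x] by (simp add: diff_divide_distrib power2_eq_square power3_eq_cube)
    ultimately show "(?W has_vector_derivative ?d x) (at x within {0..1})"
      by (simp add: has_real_derivative_iff_has_vector_derivative)
  qed simp
  moreover have "(?d has_integral (1 - c\<^sup>2) * integral {0..1} (\<lambda>x. - (8 * x * (1 - x) ^ 3) / (lambert_den c x) ^ 3) - 3 * c * lambertF c) {0..1}"
    unfolding lambertF_def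
    by (intro has_integral_diff has_integral_mult_right integrable_integral integrable_over_lambert_den c continuous_intros)
  ultimately have "(1 - c\<^sup>2) * integral {0..1} (\<lambda>x. - (8 * x * (1 - x) ^ 3) / (lambert_den c x) ^ 3) - 3 * c * lambertF c = ?W 1 - ?W 0"
    by (rule has_integral_unique[rotated])
  then show ?thesis by (simp add: lambert_den_def)
qed

lemma lambertF_has_derivative_ode:
  assumes c: "c > -1" "c \<noteq> 1"
  shows "(lambertF has_real_derivative (3 * c * lambertF c - 2) / (1 - c\<^sup>2)) (at c)"
proof -
  have "1 - c\<^sup>2 \<noteq> 0" using c by (simp add: power2_eq_1_iff)
  then have "integral {0..1} (\<lambda>x. - (8 * x * (1 - x) ^ 3) / (lambert_den c x) ^ 3) = (3 * c * lambertF c - 2) / (1 - c\<^sup>2)"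
    using lambertF_deriv_eq[OF c(1)] by (simp add: nonzero_eq_divide_eq mult.commute)
  then show ?thesis using lambertF_has_derivative[OF c(1)] by simp
qed

lemma lambertG_nonneg: "c > -1 \<Longrightarrow> lambertG c \<ge> 0"
  unfolding lambertG_def by (intro integral_nonneg integrable_over_lambert_den continuous_intros) auto

lemma continuous_on_lambertF: "continuous_on {-1<..} lambertF"
  by (intro continuous_at_imp_continuous_on ballI DERIV_isCont[OF lambertF_has_derivative]) auto

lemma lambertF_nonneg: "c > -1 \<Longrightarrow> lambertF c \<ge> 0"
  unfolding lambertF_def by (intro integral_nonneg integrable_over_lambert_den continuous_intros) auto

lemma lambertF_antimono:
  assumes "-1 < c" "c \<le> d" shows "lambertF d \<le> lambertF c"
proof (rule DERIV_nonpos_imp_nonincreasing[OF assms(2)])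
  fix x assume "c \<le> x" "x \<le> d"
  then have x: "x > -1" using assms by simp
  have "integral {0..1} (\<lambda>u. - (8 * u * (1 - u) ^ 3) / (lambert_den x u) ^ 3) \<le> integral {0..1::real} (\<lambda>u. 0)"
  proof (rule integral_le)
    show "(\<lambda>u. - (8 * u * (1 - u) ^ 3) / (lambert_den x u) ^ 3) integrable_on {0..1}"
      by (intro integrable_over_lambert_den x continuous_intros)
    show "- (8 * u * (1 - u) ^ 3) / (lambert_den x u) ^ 3 \<le> 0" if "u \<in> {0..1}" for u
      using lambert_den_pos[OF x that] that by simp
  qed (simp add: integrable_0)
  then show "\<exists>y. (lambertF has_real_derivative y) (at x) \<and> y \<le> 0"
    using lambertF_has_derivative[OF x] by auto
qed

text \<open>With \<open>d = 1 + c\<close> the denominator is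
  \<open>(1 - 2 * x)\<^sup>2 + 2 * d * x * (1 - x)\<close>. It is at most of order \<open>d\<close>
  within distance of order \<open>sqrt d\<close> from 1/2, so the integral grows at least like
  \<open>d\<close> to the power -3/2. Only the left half of that interval is used, where
  \<open>1 - x\<close> is at least 1/2.\<close>

lemma lambertF_lower:
  assumes d: "0 < d" "d \<le> 1"
  shows "1 / (9 * d * sqrt d) \<le> lambertF (d - 1)"
proof -
  let ?a = "1/2 - sqrt d / 2"
  have sd: "0 < sqrt d" "sqrt d \<le> 1" using d by auto
  have c: "d - 1 > -1" using d by simp
  define s where "s = sqrt d"
  have s: "d = s * s" "s > 0" using sd d by (auto simp: s_def)
  have "2 / (9 * (s * s)\<^sup>2) * (s / 2) = 1 / (9 * (s * s) * s)"
    using s(2) by (simp add: divide_simps power2_eq_square)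
  then have "1 / (9 * d * sqrt d) = 2 / (9 * d\<^sup>2) * (sqrt d / 2)"
    unfolding s(1)[symmetric] by (simp add: s_def)
  also have "2 / (9 * d\<^sup>2) * (sqrt d / 2) = integral {?a..1/2} (\<lambda>x. 2 / (9 * d\<^sup>2))"
    using sd by simp
  also have "\<dots> \<le> integral {?a..1/2} (\<lambda>x. 2 * (1 - x)\<^sup>2 / (lambert_den (d - 1) x)\<^sup>2)"
  proof (rule integral_le)
    show "(\<lambda>x. 2 * (1 - x)\<^sup>2 / (lambert_den (d - 1) x)\<^sup>2) integrable_on {?a..1/2}"
      by (rule integrable_subinterval_real[OF integrable_over_lambert_den[OF c]])
         (use sd in \<open>auto intro!: continuous_intros\<close>)
    fix x assume x: "x \<in> {?a..1/2}"
    then have x01: "x \<in> {0..1}" using sd(2) by (auto simp: field_simps simp del: real_sqrt_le_1_iff)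
    have "(1 - 2 * x)\<^sup>2 \<le> (sqrt d)\<^sup>2" using x by (intro power_mono) auto
    moreover have "x * (1 - x) \<le> 1/4"
      using zero_le_power2[of "1 - 2 * x"] by (simp add: power2_eq_square algebra_simps)
    then have "d * (x * (1 - x)) \<le> d * (1/4)" using d by (intro mult_left_mono) auto
    moreover have "lambert_den (d - 1) x = (1 - 2 * x)\<^sup>2 + 2 * (d * (x * (1 - x)))"
      by (simp add: lambert_den_def power2_eq_square algebra_simps)
    ultimately have "lambert_den (d - 1) x \<le> 3/2 * d" using d real_sqrt_pow2[of d] by linarith
    then have "(lambert_den (d - 1) x)\<^sup>2 \<le> (3/2 * d)\<^sup>2"
      using lambert_den_pos[OF c x01] by (intro power_mono) auto
    moreover have "(1/2)\<^sup>2 \<le> (1 - x)\<^sup>2" using x by (intro power_mono) auto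
    ultimately have "(2 * (1/2)\<^sup>2) / (3/2 * d)\<^sup>2 \<le> 2 * (1 - x)\<^sup>2 / (lambert_den (d - 1) x)\<^sup>2"
      using lambert_den_pos[OF c x01] by (intro frac_le) auto
    then show "2 / (9 * d\<^sup>2) \<le> 2 * (1 - x)\<^sup>2 / (lambert_den (d - 1) x)\<^sup>2"
      by (simp add: power2_eq_square field_simps)
  qed (intro integrable_continuous_interval continuous_intros)
  also have "\<dots> \<le> lambertF (d - 1)"
    unfolding lambertF_def
    by (intro integral_subset_le integrable_over_lambert_den[OF c] continuous_intros
        integrable_subinterval_real[OF integrable_over_lambert_den[OF c], of _ ?a "1/2"]) (use sd in auto)
  finally show ?thesis .
qed

text \<open>With \<open>f\<close> the difference of the two sides, the equation for \<open>lambertF\<close> says that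
  \<open>|1 - x\<^sup>2| powr (3/2) * f\<close> is increasing; it vanishes at \<open>x = 1\<close>.\<close>

lemma lambertF_compare:
  assumes c: "c > -1" "c \<noteq> 1"
  shows "(1 - c) * (lambertF c - (5 + 3 * c) / (3 * (1 + c)\<^sup>2)) < 0"
proof -
  \<comment> \<open>For \<open>x \<noteq> 1\<close> the subtracted fraction is the value of
    \<open>lambertF x\<close> at which the quadratic of \<open>lambertT_deriv_neg\<close> (with
    \<open>c = x\<close>) has the root \<open>k = 2 * (1 + x)\<close>. At \<open>x = 1\<close> it
    equals \<open>lambertF 1\<close>, which is 2/3.\<close>
  define f where "f = (\<lambda>x. lambertF x - (5 + 3 * x) / (3 * (1 + x)\<^sup>2))"
  \<comment> \<open>The linear equation of \<open>lambertF\<close> without its constant term, plus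
    the source \<open>1 / (3 * (1 + x) ^ 3)\<close>, which is positive on both sides of 1.\<close>
  have f': "(f has_real_derivative (3 * x * f x + (1 - x) / (3 * (1 + x)\<^sup>2)) / (1 - x\<^sup>2)) (at x)"
    if x: "x > -1" "x \<noteq> 1" for x
  proof -
    have nz: "1 - x\<^sup>2 \<noteq> 0" "1 + x \<noteq> 0" "1 - x \<noteq> 0" using x by (auto simp: power2_eq_1_iff)
    have sq: "1 - x\<^sup>2 = (1 - x) * (1 + x)" by (simp add: power2_eq_square algebra_simps)
    have "(f has_real_derivative (3 * x * lambertF x - 2) / (1 - x\<^sup>2)
         - (3 * (3 * (1 + x)\<^sup>2) - (5 + 3 * x) * (6 * (1 + x))) / ((3 * (1 + x)\<^sup>2) * (3 * (1 + x)\<^sup>2))) (at x)"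
      unfolding f_def
      by (intro DERIV_diff lambertF_has_derivative_ode x DERIV_divide)
         (use nz in \<open>auto intro!: derivative_eq_intros simp: algebra_simps\<close>)
    moreover have "(3 * x * lambertF x - 2) / (1 - x\<^sup>2)
         - (3 * (3 * (1 + x)\<^sup>2) - (5 + 3 * x) * (6 * (1 + x))) / ((3 * (1 + x)\<^sup>2) * (3 * (1 + x)\<^sup>2))
       = (3 * x * f x + (1 - x) / (3 * (1 + x)\<^sup>2)) / (1 - x\<^sup>2)"
      using nz(2,3) unfolding f_def sq by (simp add: divide_simps) algebra
    ultimately show ?thesis by simp
  qed
  have "continuous_on {-1<..} f"
    unfolding f_def by (intro continuous_intros continuous_on_lambertF) auto
  then have cont: "continuous_on S f" if "S \<subseteq> {-1<..}" for S
    using continuous_on_subset that by blast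
  show ?thesis
  proof (cases "c < 1")
    case True
    let ?g = "\<lambda>x. sqrt (1 - x\<^sup>2) * (1 - x\<^sup>2) * f x"
    have "?g c < ?g 1"
    proof (rule DERIV_pos_imp_increasing_open[OF True])
      fix x assume x: "c < x" "x < 1"
      then have xx: "1 - x\<^sup>2 > 0" using c by (simp add: abs_square_less_1)
      have "(?g has_real_derivative sqrt (1 - x\<^sup>2) * ((1 - x) / (3 * (1 + x)\<^sup>2))) (at x)"
      proof (rule DERIV_cong[OF DERIV_mult[OF _ f']])
        have "((\<lambda>x. sqrt (1 - x\<^sup>2) * (1 - x\<^sup>2)) has_real_derivative
            - 3 * x * ((1 - x\<^sup>2) / sqrt (1 - x\<^sup>2)) / 3 + - 3 * x * sqrt (1 - x\<^sup>2) * 2 / 3) (at x)"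
          by (rule derivative_eq_intros refl | use xx in force)+
             (use xx in \<open>simp add: divide_simps\<close>)
        then show "((\<lambda>x. sqrt (1 - x\<^sup>2) * (1 - x\<^sup>2)) has_real_derivative - 3 * x * sqrt (1 - x\<^sup>2)) (at x)"
          using xx by (simp add: real_div_sqrt field_simps)
        have e: "A / (1 - x\<^sup>2) * (sqrt (1 - x\<^sup>2) * (1 - x\<^sup>2)) = A * sqrt (1 - x\<^sup>2)" for A
          using xx by simp
        show "- 3 * x * sqrt (1 - x\<^sup>2) * f x + (3 * x * f x + (1 - x) / (3 * (1 + x)\<^sup>2)) / (1 - x\<^sup>2) * (sqrt (1 - x\<^sup>2) * (1 - x\<^sup>2))
            = sqrt (1 - x\<^sup>2) * ((1 - x) / (3 * (1 + x)\<^sup>2))"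
          unfolding e by (simp add: algebra_simps)
      qed (use x c in auto)
      moreover have "sqrt (1 - x\<^sup>2) * ((1 - x) / (3 * (1 + x)\<^sup>2)) > 0"
        using x xx c by (intro mult_pos_pos divide_pos_pos) auto
      ultimately show "\<exists>y. (?g has_real_derivative y) (at x) \<and> 0 < y" by blast
    qed (use c in \<open>intro continuous_intros cont; auto\<close>)
    then have lt: "sqrt (1 - c\<^sup>2) * (1 - c\<^sup>2) * f c < 0" by simp
    have "sqrt (1 - c\<^sup>2) * (1 - c\<^sup>2) > 0" using c True by (simp add: abs_square_less_1)
    then have "f c < 0" using lt by (metis linorder_not_less mult_nonneg_nonneg less_imp_le)
    then show ?thesis using True by (simp add: f_def mult_less_0_iff)
  next
    case False
    then have c1: "1 < c" using c by simp
    let ?g = "\<lambda>x. sqrt (x\<^sup>2 - 1) * (x\<^sup>2 - 1) * f x"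
    have "?g 1 < ?g c"
    proof (rule DERIV_pos_imp_increasing_open[OF c1])
      fix x assume x: "1 < x" "x < c"
      then have xx: "x\<^sup>2 - 1 > 0" by simp
      have "(?g has_real_derivative sqrt (x\<^sup>2 - 1) * ((x - 1) / (3 * (1 + x)\<^sup>2))) (at x)"
      proof (rule DERIV_cong[OF DERIV_mult[OF _ f']])
        have "((\<lambda>x. sqrt (x\<^sup>2 - 1) * (x\<^sup>2 - 1)) has_real_derivative
            3 * x * ((x\<^sup>2 - 1) / sqrt (x\<^sup>2 - 1)) / 3 + 3 * x * sqrt (x\<^sup>2 - 1) * 2 / 3) (at x)"
          by (rule derivative_eq_intros refl | use xx in force)+
             (use xx in \<open>simp add: divide_simps\<close>)
        then show "((\<lambda>x. sqrt (x\<^sup>2 - 1) * (x\<^sup>2 - 1)) has_real_derivative 3 * x * sqrt (x\<^sup>2 - 1)) (at x)"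
          using xx by (simp add: real_div_sqrt field_simps)
        have e: "A / (1 - x\<^sup>2) * (sqrt (x\<^sup>2 - 1) * (x\<^sup>2 - 1)) = - A * sqrt (x\<^sup>2 - 1)" for A
        proof -
          define B where "B = A / (1 - x\<^sup>2)"
          have A: "A = B * (1 - x\<^sup>2)" using xx by (simp add: B_def)
          have "B * (sqrt (x\<^sup>2 - 1) * (x\<^sup>2 - 1)) = - A * sqrt (x\<^sup>2 - 1)"
            unfolding A by (simp add: algebra_simps)
          then show ?thesis by (simp only: B_def)
        qed
        have e': "(x - 1) / k = - ((1 - x) / k)" for k by (metis minus_diff_eq minus_divide_left)
        show "3 * x * sqrt (x\<^sup>2 - 1) * f x + (3 * x * f x + (1 - x) / (3 * (1 + x)\<^sup>2)) / (1 - x\<^sup>2) * (sqrt (x\<^sup>2 - 1) * (x\<^sup>2 - 1))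
            = sqrt (x\<^sup>2 - 1) * ((x - 1) / (3 * (1 + x)\<^sup>2))"
          unfolding e e' by (simp add: algebra_simps)
      qed (use x c in auto)
      moreover have "sqrt (x\<^sup>2 - 1) * ((x - 1) / (3 * (1 + x)\<^sup>2)) > 0"
        using x xx c by (intro mult_pos_pos divide_pos_pos) auto
      ultimately show "\<exists>y. (?g has_real_derivative y) (at x) \<and> 0 < y" by blast
    qed (use c in \<open>intro continuous_intros cont; auto\<close>)
    then have lt: "0 < sqrt (c\<^sup>2 - 1) * (c\<^sup>2 - 1) * f c" by simp
    have "sqrt (c\<^sup>2 - 1) * (c\<^sup>2 - 1) > 0" using c1 by simp
    then have "f c > 0" using lt zero_less_mult_pos by blast
    then show ?thesis using c1 by (simp add: f_def mult_less_0_iff)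
  qed
qed

text \<open>Here \<open>m = |A| + |B|\<close>.\<close>

definition lambertT :: "real \<Rightarrow> real \<Rightarrow> real \<Rightarrow> real" where
  "lambertT m p c = sqrt (2 * (m - 2 * p * c)) * ((m - 2 * p * c) / 2 * lambertF c + p)"

text \<open>The left-hand side is \<open>sqrt (2 * w)\<close> times the derivative of \<open>lambertT m p\<close> at \<open>c\<close>. It is a concave
  quadratic form in \<open>k = w / |p|\<close>, and \<open>2 * |p| < m\<close> means \<open>k > 2 * (1 + c)\<close>; there it is negative
  by the previous comparison.\<close>

lemma lambertT_deriv_neg:
  assumes c: "c > -1" "c \<noteq> 1" and p: "p < 0" "- 2 * p < m"
  defines "w \<equiv> m - 2 * p * c"
  shows "w\<^sup>2 * ((3 * c * lambertF c - 2) / (1 - c\<^sup>2)) - 3 * p * w * lambertF c - 2 * p\<^sup>2 < 0"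
proof -
  define F where "F = lambertF c"
  define F' where "F' = (3 * c * F - 2) / (1 - c\<^sup>2)"
  define R where "R = (5 + 3 * c) / (3 * (1 + c)\<^sup>2)"
  define k where "k = w / (- p)"
  have F0: "F \<ge> 0" using lambertF_nonneg c by (simp add: F_def)
  have FR: "(1 - c) * (F - R) < 0" using lambertF_compare[OF c] by (simp add: F_def R_def)
  have nz: "1 - c\<^sup>2 \<noteq> 0" using c by (auto simp: power2_eq_1_iff)
  have ode: "(1 - c) * (1 + c) * F' = 3 * c * F - 2"
  proof -
    have "(1 - c\<^sup>2) * F' = 3 * c * F - 2" using nz by (simp add: F'_def)
    then show ?thesis by algebra
  qed
  have R: "3 * (1 + c)\<^sup>2 * R = 5 + 3 * c" using c by (simp add: R_def)
  \<comment> \<open>Slope of the quadratic \<open>F' * k\<^sup>2 + 3 * F * k - 2\<close> at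
    \<open>k = 2 * (1 + c)\<close>; \<open>ii\<close> treats its value there. With
    \<open>F' < 0\<close>, Taylor expansion at this point keeps the quadratic negative for all
    larger \<open>k\<close>.\<close>
  have i: "4 * (1 + c) * F' + 3 * F < 0"
  proof -
    have "(1 - c) * (4 * (1 + c) * F' + 3 * F) = (9 * c + 3) * F - 8" using ode by algebra
    moreover have "(9 * c + 3) * R - 8 = 3 * (c + 3) * (c - 1) / (3 * (1 + c)\<^sup>2)"
      using c by (simp add: R_def divide_simps) algebra
    moreover have "(1 - c) * ((9 * c + 3) * F - 8) < 0"
    proof (cases "c < 1")
      case True
      then have FR': "F < R" using FR by (simp add: mult_less_0_iff)
      have "3 * (c + 3) * (c - 1) / (3 * (1 + c)\<^sup>2) < 0"
        using True c by (intro divide_neg_pos mult_pos_neg) auto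
      then have "(9 * c + 3) * R < 8" using calculation by simp
      moreover have "(9 * c + 3) * F \<le> (9 * c + 3) * R \<or> (9 * c + 3) * F \<le> 0"
        using FR' F0 by (cases "9 * c + 3 \<ge> 0") (auto intro: mult_left_mono simp: mult_nonpos_nonneg)
      ultimately have "(9 * c + 3) * F < 8" by linarith
      then show ?thesis using True by (simp add: mult_pos_neg)
    next
      case False
      then have c1: "c > 1" using c by simp
      then have FR': "R < F" using FR by (simp add: mult_less_0_iff)
      have "3 * (c + 3) * (c - 1) / (3 * (1 + c)\<^sup>2) > 0" using c1 by simp
      then have "8 < (9 * c + 3) * R" using calculation by simp
      also have "\<dots> \<le> (9 * c + 3) * F" using FR' c1 by (intro mult_left_mono) auto
      finally show ?thesis using c1 by (simp add: mult_neg_pos)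
    qed
    ultimately have "(1 - c)\<^sup>2 * (4 * (1 + c) * F' + 3 * F) < 0"
      by (simp add: power2_eq_square mult.assoc)
    then show ?thesis by (simp add: mult_less_0_iff)
  qed
  have ii: "4 * (1 + c)\<^sup>2 * F' + 6 * (1 + c) * F - 2 < 0"
  proof -
    have "(1 - c) * (4 * (1 + c)\<^sup>2 * F' + 6 * (1 + c) * F - 2) = 6 * (1 + c)\<^sup>2 * (F - R)"
      using ode R by algebra
    then have "(1 - c)\<^sup>2 * (4 * (1 + c)\<^sup>2 * F' + 6 * (1 + c) * F - 2) = 6 * (1 + c)\<^sup>2 * ((1 - c) * (F - R))"
      by (simp add: power2_eq_square mult.assoc)
    also have "\<dots> < 0" using FR c by (intro mult_pos_neg[of "6 * (1 + c)\<^sup>2"]) auto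
    finally show ?thesis by (simp add: mult_less_0_iff)
  qed
  have "(1 + c) * F' < 0" using i F0 by (simp only: mult.assoc)
  then have F'neg: "F' < 0" using c by (simp add: mult_less_0_iff)
  have w: "w = k * (- p)" using p by (simp add: k_def)
  have "m / (- p) > 2" using p by (simp add: field_simps)
  moreover have "k = m / (- p) + 2 * c" using p by (simp add: k_def w_def field_simps)
  ultimately have k: "k > 2 * (1 + c)" by simp
  have "F' * k\<^sup>2 + 3 * F * k - 2 = (4 * (1 + c)\<^sup>2 * F' + 6 * (1 + c) * F - 2)
      + (k - 2 * (1 + c)) * (F' * (k - 2 * (1 + c)) + (4 * (1 + c) * F' + 3 * F))" by algebra
  also have "\<dots> < 0"
  proof -
    have "F' * (k - 2 * (1 + c)) < 0" using F'neg k by (intro mult_neg_pos) auto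
    then have "(k - 2 * (1 + c)) * (F' * (k - 2 * (1 + c)) + (4 * (1 + c) * F' + 3 * F)) < 0"
      using i k by (intro mult_pos_neg[of "k - 2 * (1 + c)"]) linarith+
    then show ?thesis using ii by linarith
  qed
  finally have "p\<^sup>2 * (F' * k\<^sup>2 + 3 * F * k - 2) < 0" using p by (intro mult_pos_neg) auto
  moreover have "w\<^sup>2 * F' - 3 * p * w * F - 2 * p\<^sup>2 = p\<^sup>2 * (F' * k\<^sup>2 + 3 * F * k - 2)"
    unfolding w by algebra
  ultimately show ?thesis by (simp add: F_def F'_def)
qed

section \<open>Monotonicity and range of the transfer time\<close>

lemma continuous_on_lambertT: "continuous_on {-1<..} (lambertT m p)"
  unfolding lambertT_def by (intro continuous_intros continuous_on_lambertF) auto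

lemma lambertT_strict_decreasing_indirect:
  assumes "-1 < c" "c < d" and p: "p < 0" "- 2 * p < m"
  shows "lambertT m p d < lambertT m p c"
proof -
  \<comment> \<open>The formula for the derivative divides by \<open>1 - x\<^sup>2\<close>, so the
    interval must lie on one side of 1. Continuity at 1 lets the two sides be chained.\<close>
  have step: "lambertT m p d < lambertT m p c" if cd: "-1 < c" "c < d" "d \<le> 1 \<or> 1 \<le> c" for c d
  proof (rule DERIV_neg_imp_decreasing_open[OF cd(2)])
    fix x assume x: "c < x" "x < d"
    then have x': "x > -1" "x \<noteq> 1" using cd by auto
    let ?w = "m - 2 * p * x" and ?F' = "(3 * x * lambertF x - 2) / (1 - x\<^sup>2)"
    have "p * (1 + x) < 0" using p x' by (intro mult_neg_pos) auto
    moreover have "p * (1 + x) = p + p * x" by algebra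
    ultimately have w: "?w > 0" using p by linarith
    have "(lambertT m p has_real_derivative
       (?w\<^sup>2 * ?F' - 3 * p * ?w * lambertF x - 2 * p\<^sup>2) / sqrt (2 * ?w)) (at x)"
      unfolding lambertT_def
    proof (rule DERIV_cong[OF DERIV_mult])
      show "((\<lambda>x. sqrt (2 * (m - 2 * p * x))) has_real_derivative - 2 * p / sqrt (2 * ?w)) (at x)"
        by (rule derivative_eq_intros refl | use w in force)+
           (use w in \<open>simp add: divide_simps\<close>)
      show "((\<lambda>x. (m - 2 * p * x) / 2 * lambertF x + p) has_real_derivative - p * lambertF x + ?w / 2 * ?F') (at x)"
        by (rule DERIV_cong[OF DERIV_add[OF DERIV_mult[OF _ lambertF_has_derivative_ode] DERIV_const]])
           (use x' in \<open>auto intro!: derivative_eq_intros simp: algebra_simps\<close>)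
      define G S where "G = ?F'" and "S = sqrt (2 * ?w)"
      have S: "S \<noteq> 0" "S * S = 2 * ?w" using w by (auto simp: S_def)
      have "- 2 * p / S * (?w / 2 * lambertF x + p) + (- p * lambertF x + ?w / 2 * G) * S
          = (- 2 * p * (?w / 2 * lambertF x + p) + (- p * lambertF x + ?w / 2 * G) * (S * S)) / S"
        using S(1) by (simp add: field_simps)
      also have "\<dots> = (?w\<^sup>2 * G - 3 * p * ?w * lambertF x - 2 * p\<^sup>2) / S"
        unfolding S(2) by (rule arg_cong[where f="\<lambda>u. u / S"]) (simp add: field_simps power2_eq_square)
      finally show "- 2 * p / sqrt (2 * ?w) * (?w / 2 * lambertF x + p) + (- p * lambertF x + ?w / 2 * ?F') * sqrt (2 * ?w)
          = (?w\<^sup>2 * ?F' - 3 * p * ?w * lambertF x - 2 * p\<^sup>2) / sqrt (2 * ?w)"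
        unfolding G_def S_def .
    qed
    moreover have "(?w\<^sup>2 * ?F' - 3 * p * ?w * lambertF x - 2 * p\<^sup>2) / sqrt (2 * ?w) < 0"
      using lambertT_deriv_neg[OF x' p] w by (intro divide_neg_pos) auto
    ultimately show "\<exists>y. (lambertT m p has_real_derivative y) (at x) \<and> y < 0" by blast
  qed (use cd in \<open>auto intro: continuous_on_subset[OF continuous_on_lambertT]\<close>)
  consider "d \<le> 1 \<or> 1 \<le> c" | "c < 1" "1 < d" by linarith
  then show ?thesis
    using step[of c d] step[of c 1] step[of 1 d] assms by cases auto
qed

text \<open>For \<open>p > 0\<close> the weight \<open>m - 2 * p * c\<close> decreases together with
  \<open>lambertF\<close>: the root decreases strictly, the other factor does not increase, and a
  positive weight at \<open>d\<close> keeps both positive.\<close>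

lemma lambertT_strict_decreasing_direct:
  assumes "-1 < c" "c < d" and p: "p > 0" and w: "m - 2 * p * d > 0"
  shows "lambertT m p d < lambertT m p c"
proof -
  have lt: "m - 2 * p * d < m - 2 * p * c" using assms by simp
  then have wc: "m - 2 * p * c > 0" using w by linarith
  have "(m - 2 * p * d) / 2 * lambertF d \<le> (m - 2 * p * c) / 2 * lambertF c"
    using assms wc lambertF_antimono[of c d] lambertF_nonneg[of d] by (intro mult_mono) auto
  moreover have "0 < (m - 2 * p * d) / 2 * lambertF d + p"
    using w p lambertF_nonneg[of d] assms by (intro add_nonneg_pos mult_nonneg_nonneg) auto
  moreover have "sqrt (2 * (m - 2 * p * d)) < sqrt (2 * (m - 2 * p * c))" using lt by simp
  moreover have "0 \<le> sqrt (2 * (m - 2 * p * d))"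
    using w by (intro real_sqrt_ge_zero mult_nonneg_nonneg) linarith+
  ultimately show ?thesis unfolding lambertT_def
    by (intro mult_less_le_imp_less) auto
qed

lemma lambertT_strict_decreasing:
  assumes "-1 < c" "c < d" "p \<noteq> 0" "2 * \<bar>p\<bar> < m" "m - 2 * p * d > 0"
  shows "lambertT m p d < lambertT m p c"
  using lambertT_strict_decreasing_indirect[of c d p m] lambertT_strict_decreasing_direct[of c d p m] assms
  by (cases "p < 0") auto

lemma lambertT_inj:
  assumes "-1 < c" "-1 < d" "p \<noteq> 0" "2 * \<bar>p\<bar> < m" "m - 2 * p * c > 0" "m - 2 * p * d > 0"
    and "lambertT m p c = lambertT m p d"
  shows "c = d"
  using lambertT_strict_decreasing[of c d p m] lambertT_strict_decreasing[of d c p m] assms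
  by (cases c d rule: linorder_cases) auto

text \<open>As \<open>c\<close> tends to -1 the energy \<open>(c\<^sup>2 - 1) / w\<close> tends to 0
  from below: the arcs run through the far ends of ever longer ellipses.\<close>

lemma lambertT_unbounded:
  assumes m: "2 * \<bar>p\<bar> < m" and "T > 0"
  obtains c where "-1 < c" "c \<le> 0" "lambertT m p c \<ge> T"
proof -
  define u where "u = m - 2 * \<bar>p\<bar>"
  have u: "u > 0" using m by (simp add: u_def)
  \<comment> \<open>\<open>u\<close> bounds the weight from below for \<open>c\<close> in (-1, 0],
    and \<open>lambertF = Y\<close> would turn the resulting lower bound of \<open>lambertT\<close>
    into exactly \<open>T\<close>. The later choice of \<open>d\<close> gives
    \<open>1 / (9 * d) = Y + 1\<close>.\<close>
  define Y where "Y = (T / sqrt (2 * u) + \<bar>p\<bar>) / (u / 2)"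
  have Y: "Y \<ge> 0" using u \<open>T > 0\<close> by (simp add: Y_def)
  define d where "d = 1 / (9 * Y + 9)"
  have d: "0 < d" "d \<le> 1" using Y by (auto simp: d_def)
  have "Y \<le> 1 / (9 * d)" using Y by (simp add: d_def)
  also have "\<dots> \<le> 1 / (9 * d * sqrt d)" using d by (intro divide_left_mono) (auto simp: mult_le_cancel_left1)
  also have "\<dots> \<le> lambertF (d - 1)" by (rule lambertF_lower[OF d])
  finally have "u / 2 * Y \<le> u / 2 * lambertF (d - 1)" using u by (intro mult_left_mono) auto
  moreover have "u / 2 * Y = T / sqrt (2 * u) + \<bar>p\<bar>" using u by (simp add: Y_def)
  moreover have "u \<le> m - 2 * p * (d - 1)"
  proof -
    have "- p * (1 - d) \<le> \<bar>p\<bar> * (1 - d)" using d by (intro mult_right_mono) auto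
    moreover have "\<bar>p\<bar> * (1 - d) \<le> \<bar>p\<bar> * 1" using d by (intro mult_left_mono) auto
    moreover have "- p * (1 - d) = p * (d - 1)" by algebra
    ultimately show ?thesis by (simp add: u_def)
  qed
  moreover from this have "u / 2 * lambertF (d - 1) \<le> (m - 2 * p * (d - 1)) / 2 * lambertF (d - 1)"
    using lambertF_nonneg[of "d - 1"] d by (intro mult_right_mono) auto
  ultimately have A: "T / sqrt (2 * u) \<le> (m - 2 * p * (d - 1)) / 2 * lambertF (d - 1) + p"
    and B: "u \<le> m - 2 * p * (d - 1)" by linarith+
  have "T = sqrt (2 * u) * (T / sqrt (2 * u))" using u by simp
  also have "\<dots> \<le> lambertT m p (d - 1)"
    unfolding lambertT_def using A u B \<open>T > 0\<close> by (intro mult_mono real_sqrt_le_mono real_sqrt_ge_zero) auto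
  finally show ?thesis using d by (intro that[of "d - 1"]) auto
qed

text \<open>By \<open>lambertF_plus_G\<close>, \<open>lambertF c\<close> is at most
  \<open>1 / c\<close>, so the second factor is at most \<open>m / (2 * c)\<close>, while the root
  grows only like \<open>sqrt c\<close>. The product is at most \<open>M / sqrt c\<close>.\<close>

lemma lambertT_small_indirect:
  assumes p: "p < 0" "- 2 * p < m" and "T > 0"
  obtains c where "1 \<le> c" "lambertT m p c \<le> T"
proof -
  define M where "M = sqrt (2 * (m - 2 * p)) * m / 2"
  have M: "M > 0" using p by (simp add: M_def)
  define c where "c = (max 1 (M / T))\<^sup>2"
  have sc: "sqrt c = max 1 (M / T)" by (simp add: c_def)
  have c: "c \<ge> 1" by (simp add: c_def)
  have G: "c * lambertF c + lambertG c = 1" "lambertG c \<ge> 0" using lambertF_plus_G lambertG_nonneg c by auto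
  have F: "lambertF c \<le> 1 / c" using G c by (simp add: field_simps)
  have "(m - 2 * p * c) / 2 * lambertF c + p = m / 2 * lambertF c + p * lambertG c"
    using G(1) by algebra
  also have "\<dots> \<le> m / 2 * (1 / c)"
    using F G(2) p mult_left_mono[OF F, of "m / 2"] mult_nonpos_nonneg[of p "lambertG c"] by auto
  finally have A: "(m - 2 * p * c) / 2 * lambertF c + p \<le> m / 2 * (1 / c)" .
  have "m \<le> m * c" using c p by (simp add: mult_le_cancel_left1)
  then have "2 * (m - 2 * p * c) \<le> c * (2 * (m - 2 * p))" by (simp add: algebra_simps)
  then have B: "sqrt (2 * (m - 2 * p * c)) \<le> sqrt c * sqrt (2 * (m - 2 * p))"
    by (simp add: real_sqrt_mult[symmetric])
  have wp: "m - 2 * p * c > 0"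
  proof -
    have "p * c < 0" using p c by (intro mult_neg_pos) auto
    then show ?thesis using p by linarith
  qed
  have "lambertT m p c \<le> sqrt (2 * (m - 2 * p * c)) * (m / 2 * (1 / c))"
    unfolding lambertT_def
    by (intro mult_left_mono[OF A] real_sqrt_ge_zero mult_nonneg_nonneg) (use wp in linarith)+
  also have "\<dots> \<le> (sqrt c * sqrt (2 * (m - 2 * p))) * (m / 2 * (1 / c))"
    using B p c by (intro mult_right_mono) auto
  also have "\<dots> = M / sqrt c"
    using c real_sqrt_mult_self[of c] by (simp add: M_def field_simps)
  also have "\<dots> \<le> T"
  proof -
    have "M / T \<le> sqrt c" by (simp add: sc)
    then show ?thesis using \<open>T > 0\<close> c by (simp add: field_simps)
  qed
  finally show ?thesis using c that by blast
qed

lemma lambertT_surj: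
  assumes p: "p \<noteq> 0" and m: "2 * \<bar>p\<bar> < m" and T: "T > 0"
  obtains c where "-1 < c" "m - 2 * p * c > 0" "lambertT m p c = T"
proof -
  obtain a where a: "-1 < a" "a \<le> 0" "lambertT m p a \<ge> T"
    using lambertT_unbounded[OF m T] .
  \<comment> \<open>For \<open>p > 0\<close> the right end is the zero of the weight, where the time
    is 0. The last property is recorded because \<open>c \<le> b\<close> must later yield a
    nonnegative weight.\<close>
  obtain b where b: "0 < b" "lambertT m p b \<le> T" "p > 0 \<Longrightarrow> b = m / (2 * p)"
  proof (cases "p < 0")
    case True
    then show ?thesis using lambertT_small_indirect[of p m T] m T that by force
  next
    case False
    then have "lambertT m p (m / (2 * p)) = 0" "m / (2 * p) > 0" using p m by (auto simp: lambertT_def)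
    then show ?thesis using that T by force
  qed
  have "\<exists>c\<ge>a. c \<le> b \<and> lambertT m p c = T"
    by (rule IVT2') (use a b in \<open>auto intro: continuous_on_subset[OF continuous_on_lambertT]\<close>)
  then obtain c where c: "a \<le> c" "c \<le> b" "lambertT m p c = T" by blast
  have "m - 2 * p * c > 0"
  proof (cases "p < 0")
    case True
    have "p * (1 + c) < 0" using True a c by (intro mult_neg_pos) auto
    moreover have "p * (1 + c) = p + p * c" by algebra
    ultimately show ?thesis using m True by linarith
  next
    case False
    then have "c \<le> m / (2 * p)" using b c p by simp
    then have "m - 2 * p * c \<ge> 0" using False p by (simp add: field_simps)
    moreover have "m - 2 * p * c \<noteq> 0"
    proof
      assume "m - 2 * p * c = 0"
      then have "lambertT m p c = 0" unfolding lambertT_def by (simp only:) simp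
      then show False using c T by simp
    qed
    ultimately show ?thesis by simp
  qed
  then show ?thesis using that[of c] c a by auto
qed


section \<open>Distance and time along an arc as functions of \<open>x\<close>\<close>

definition lambert_num :: "real \<Rightarrow> real \<Rightarrow> real \<Rightarrow> real \<Rightarrow> real" where
  "lambert_num a b p x = (1 - x)\<^sup>2 * a + x\<^sup>2 * b + 2 * p * x * (1 - x)"

definition lambert_time :: "real \<Rightarrow> real \<Rightarrow> real \<Rightarrow> real \<Rightarrow> real \<Rightarrow> real" where
  "lambert_time a b p c x =
     sqrt (2 * (a + b - 2 * p * c)) * integral {0..x} (\<lambda>u. lambert_num a b p u / (lambert_den c u)\<^sup>2)"

lemma lambert_num_has_derivative [derivative_intros]:
  "((\<lambda>x. lambert_num a b p x) has_real_derivative 2 * (x * b - (1 - x) * a + p * (1 - 2 * x))) (at x within S)"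
  unfolding lambert_num_def by (auto intro!: derivative_eq_intros simp: algebra_simps)

lemma continuous_on_lambert_num [continuous_intros]: "continuous_on S (\<lambda>x. lambert_num a b p x)"
  unfolding lambert_num_def by (intro continuous_intros)

text \<open>\<open>lambert_num\<close> is \<open>|(1 - x) \<alpha> + x \<beta>|\<^sup>2\<close> with
  \<open>a = |\<alpha>|\<^sup>2\<close>, \<open>b = |\<beta>|\<^sup>2\<close>. The two squares are
  those of the real and imaginary parts after multiplication by \<open>cnj \<alpha>\<close>. Hence a
  zero, that is a collision, forces \<open>p\<^sup>2 = a * b\<close>: \<open>\<alpha>\<close> and
  \<open>\<beta>\<close> are parallel and the motion is rectilinear.\<close>

lemma lambert_num_eq:
  assumes "a \<noteq> 0"
  shows "lambert_num a b p x = (((1 - x) * a + p * x)\<^sup>2 + x\<^sup>2 * (a * b - p\<^sup>2)) / a"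
proof -
  have "a * lambert_num a b p x = ((1 - x) * a + p * x)\<^sup>2 + x\<^sup>2 * (a * b - p\<^sup>2)"
    unfolding lambert_num_def by algebra
  then show ?thesis using assms by (metis nonzero_mult_div_cancel_left)
qed

lemma lambert_num_nonneg: "a > 0 \<Longrightarrow> p\<^sup>2 \<le> a * b \<Longrightarrow> lambert_num a b p x \<ge> 0"
  by (subst lambert_num_eq) auto

lemma lambert_num_eq_0D:
  assumes "a > 0" "p\<^sup>2 \<le> a * b" "lambert_num a b p x = 0"
  shows "p\<^sup>2 = a * b" "(1 - x) * a + p * x = 0"
proof -
  have "((1 - x) * a + p * x)\<^sup>2 + x\<^sup>2 * (a * b - p\<^sup>2) = 0"
    using assms(1,3) by (subst (asm) lambert_num_eq) auto
  moreover have "x\<^sup>2 * (a * b - p\<^sup>2) \<ge> 0" using assms(2) by simp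
  ultimately have *: "((1 - x) * a + p * x)\<^sup>2 = 0" "x\<^sup>2 * (a * b - p\<^sup>2) = 0"
    by (smt (verit) zero_le_power2)+
  then show "(1 - x) * a + p * x = 0" by simp
  then have "x \<noteq> 0" using assms(1) by auto
  then show "p\<^sup>2 = a * b" using * by simp
qed

lemma finite_lambert_num_zeros:
  assumes "a > 0" "p\<^sup>2 \<le> a * b"
  shows "finite {x. lambert_num a b p x = 0}"
proof (rule finite_subset)
  show "{x. lambert_num a b p x = 0} \<subseteq> {a / (a - p)}"
  proof clarify
    fix x assume "lambert_num a b p x = 0"
    then have "(1 - x) * a + p * x = 0" using lambert_num_eq_0D assms by blast
    then have "x * (a - p) = a" by algebra
    moreover from this have "a - p \<noteq> 0" using assms(1) by auto
    ultimately show "x = a / (a - p)" by (simp add: nonzero_eq_divide_eq)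
  qed
qed simp

lemma lambert_time_has_derivative:
  assumes c: "c > -1" and x: "x \<in> {0..1}"
  shows "(lambert_time a b p c has_real_derivative
     sqrt (2 * (a + b - 2 * p * c)) * (lambert_num a b p x / (lambert_den c x)\<^sup>2)) (at x within {0..1})"
proof -
  have "continuous_on {0..1} (\<lambda>u. lambert_num a b p u / (lambert_den c u)\<^sup>2)"
    using lambert_den_pos[OF c] by (intro continuous_intros) force
  from integral_has_vector_derivative[OF this x]
  show ?thesis unfolding lambert_time_def
    by (intro DERIV_cmult) (simp add: has_real_derivative_iff_has_vector_derivative)
qed

lemma lambert_time_0 [simp]: "lambert_time a b p c 0 = 0"
  by (simp add: lambert_time_def)

text \<open>That only \<open>a + b\<close> survives is Lambert's theorem:
  \<open>4 * p\<^sup>2\<close> is \<open>(a + b)\<^sup>2\<close> minus the squared chord, so besides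
  \<open>c\<close> and the sign of \<open>p\<close> the time depends only on the sum of the
  distances and on the chord.\<close>

lemma lambert_time_1:
  assumes c: "c > -1" shows "lambert_time a b p c 1 = lambertT (a + b) p c"
proof -
  have "((\<lambda>u. a / 2 * (2 * (1 - u)\<^sup>2 / (lambert_den c u)\<^sup>2) + b / 2 * (2 * u\<^sup>2 / (lambert_den c u)\<^sup>2)
        + p * (2 * (u * (1 - u)) / (lambert_den c u)\<^sup>2)) has_integral
        a / 2 * lambertF c + b / 2 * lambertF c + p * lambertG c) {0..1}"
    by (intro has_integral_add has_integral_mult_right lambertF_reflect c)
       (unfold lambertF_def lambertG_def, (intro integrable_integral integrable_over_lambert_den c continuous_intros)+)
  moreover have "a / 2 * (2 * (1 - u)\<^sup>2 / (lambert_den c u)\<^sup>2) + b / 2 * (2 * u\<^sup>2 / (lambert_den c u)\<^sup>2)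
        + p * (2 * (u * (1 - u)) / (lambert_den c u)\<^sup>2) = lambert_num a b p u / (lambert_den c u)\<^sup>2" for u
  proof -
    have "lambert_num a b p u = a * (1 - u)\<^sup>2 + b * u\<^sup>2 + p * (2 * (u * (1 - u)))"
      unfolding lambert_num_def by algebra
    then show ?thesis by (simp add: add_divide_distrib)
  qed
  ultimately have "integral {0..1} (\<lambda>u. lambert_num a b p u / (lambert_den c u)\<^sup>2)
      = a / 2 * lambertF c + b / 2 * lambertF c + p * lambertG c"
    by (simp add: integral_unique)
  also have "\<dots> = (a + b - 2 * p * c) / 2 * lambertF c + p"
    using lambertF_plus_G[OF c] by algebra
  finally show ?thesis by (simp add: lambert_time_def lambertT_def)
qed

text \<open>Collisions are the exceptional points: there \<open>lambert_time\<close> has derivative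
  0, whereas the derivative of the regularizing time \<open>s\<close> blows up. The induction splits
  the interval at one exceptional point.\<close>

lemma strict_increasing_except_finite:
  fixes f f' :: "real \<Rightarrow> real"
  assumes "finite K" "a < b" "continuous_on {a..b} f"
    and "\<And>x. x \<in> {a..b} - K \<Longrightarrow> (f has_real_derivative f' x) (at x within {a..b})"
    and "\<And>x. x \<in> {a..b} - K \<Longrightarrow> f' x > 0"
  shows "f a < f b"
  using assms
proof (induction "card (K \<inter> {a<..<b})" arbitrary: a b rule: less_induct)
  case less
  show ?case
  proof (cases "K \<inter> {a<..<b} = {}")
    case True
    show ?thesis
    proof (rule DERIV_pos_imp_increasing_open[OF less.prems(2) _ less.prems(3)])
      fix x assume x: "a < x" "x < b"
      then have "x \<in> {a..b} - K" using True by auto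
      then show "\<exists>y. (f has_real_derivative y) (at x) \<and> 0 < y"
        using less.prems(4,5)[of x] x by (auto simp: at_within_Icc_at)
    qed
  next
    case False
    then obtain k where k: "k \<in> K" "a < k" "k < b" by auto
    have "f u < f v" if uv: "u < v" "{u..v} \<subseteq> {a..b}" "k \<notin> {u<..<v}" for u v
    proof (rule less.hyps[OF _ less.prems(1) uv(1)])
      have "a \<le> u" "v \<le> b" using uv(1,2) by auto
      then have "K \<inter> {u<..<v} \<subset> K \<inter> {a<..<b}" using uv(1,3) k by auto
      then show "card (K \<inter> {u<..<v}) < card (K \<inter> {a<..<b})"
        using less.prems(1) by (intro psubset_card_mono) auto
      show "continuous_on {u..v} f" using less.prems(3) uv(2) continuous_on_subset by blast
      show "(f has_real_derivative f' x) (at x within {u..v})" "f' x > 0" if "x \<in> {u..v} - K" for x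
        using that less.prems(4,5)[of x] uv(2) by (auto intro: DERIV_subset)
    qed
    from this[of a k] this[of k b] k show ?thesis by auto
  qed
qed

lemma lambert_time_strict_mono:
  assumes c: "c > -1" and w: "a + b - 2 * p * c > 0" and "a > 0" "p\<^sup>2 \<le> a * b"
    and x: "0 \<le> x" "x < y" "y \<le> 1"
  shows "lambert_time a b p c x < lambert_time a b p c y"
proof (rule strict_increasing_except_finite[OF finite_lambert_num_zeros[OF assms(3,4)] x(2)])
  let ?f' = "\<lambda>x. sqrt (2 * (a + b - 2 * p * c)) * (lambert_num a b p x / (lambert_den c x)\<^sup>2)"
  show d: "(lambert_time a b p c has_real_derivative ?f' z) (at z within {x..y})"
    if "z \<in> {x..y} - {x. lambert_num a b p x = 0}" for z
    using that x by (intro DERIV_subset[OF lambert_time_has_derivative[OF c]]) auto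
  show "?f' z > 0" if z: "z \<in> {x..y} - {x. lambert_num a b p x = 0}" for z
  proof -
    have "lambert_den c z > 0" using lambert_den_pos[OF c] z x by auto
    moreover have "lambert_num a b p z > 0" using z lambert_num_nonneg[OF assms(3,4), of z] by auto
    ultimately show ?thesis using w by (intro mult_pos_pos divide_pos_pos real_sqrt_gt_zero) auto
  qed
  show "continuous_on {x..y} (lambert_time a b p c)"
    using x by (intro DERIV_continuous_on[where D="?f'"] DERIV_subset[OF lambert_time_has_derivative[OF c]]) auto
qed

section \<open>The rational family of arcs\<close>

text \<open>\<open>lambert_mid A B p\<close> is the complex product \<open>\<alpha> \<beta>\<close> when \<open>A = \<alpha>\<^sup>2\<close>, \<open>B = \<beta>\<^sup>2\<close> and \<open>p = Re (\<alpha> cnj \<beta>)\<close>,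
  written without reference to a plane.\<close>

definition lambert_mid :: "'a::euclidean_space \<Rightarrow> 'a \<Rightarrow> real \<Rightarrow> 'a" where
  "lambert_mid A B p = (1 / (2 * p)) *\<^sub>R (norm B *\<^sub>R A + norm A *\<^sub>R B)"

definition lambert_quad :: "'a::euclidean_space \<Rightarrow> 'a \<Rightarrow> real \<Rightarrow> real \<Rightarrow> 'a" where
  "lambert_quad A B p x = (1 - x)\<^sup>2 *\<^sub>R A + x\<^sup>2 *\<^sub>R B + (2 * x * (1 - x)) *\<^sub>R lambert_mid A B p"

definition lambert_point :: "'a::euclidean_space \<Rightarrow> 'a \<Rightarrow> real \<Rightarrow> real \<Rightarrow> real \<Rightarrow> 'a" where
  "lambert_point A B p c x = (1 / lambert_den c x) *\<^sub>R lambert_quad A B p x"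

text \<open>\<open>p_sq\<close> is the half-angle formula for
  \<open>p = \<plusminus> sqrt (a * b) * cos (\<phi> / 2)\<close>, with \<open>\<phi>\<close> the
  angle between \<open>A\<close> and \<open>B\<close>. The value \<open>p = 0\<close> means opposite
  directions, for which no plane is singled out.\<close>

locale lambert_endpoints =
  fixes A B :: "'a::euclidean_space" and p :: real
  assumes nz: "A \<noteq> 0" "B \<noteq> 0" "A \<noteq> B" "p \<noteq> 0"
    and p_sq: "2 * p\<^sup>2 = norm A * norm B + A \<bullet> B"
begin

abbreviation "a \<equiv> norm A"
abbreviation "b \<equiv> norm B"
abbreviation "C \<equiv> lambert_mid A B p"
abbreviation "N \<equiv> lambert_num (norm A) (norm B) p"
abbreviation "Q \<equiv> lambert_quad A B p"

lemma ab_pos: "a > 0" "b > 0" using nz by auto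

lemma p_sq_le: "p\<^sup>2 \<le> a * b"
  using p_sq norm_cauchy_schwarz[of A B] by simp

lemma p_lt: "2 * \<bar>p\<bar> < a + b"
proof -
  have "(a + b)\<^sup>2 - (2 * \<bar>p\<bar>)\<^sup>2 = (A - B) \<bullet> (A - B)"
  proof -
    have "(A - B) \<bullet> (A - B) = a\<^sup>2 + b\<^sup>2 - 2 * (A \<bullet> B)"
      unfolding power2_norm_eq_inner by (simp add: inner_diff inner_commute)
    moreover have "(2 * \<bar>p\<bar>)\<^sup>2 = 4 * p\<^sup>2" by (simp add: power_mult_distrib)
    ultimately show ?thesis using p_sq by (simp add: power2_sum)
  qed
  also have "\<dots> > 0" using nz by simp
  finally have "(2 * \<bar>p\<bar>)\<^sup>2 < (a + b)\<^sup>2" by linarith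
  then show ?thesis by (rule power_less_imp_less_base) simp
qed

text \<open>In complex form \<open>|\<beta>|\<^sup>2 \<alpha>\<^sup>2 + |\<alpha>|\<^sup>2
  \<beta>\<^sup>2 = \<alpha> \<beta> (\<alpha> cnj \<beta> + \<beta> cnj \<alpha>)\<close>, and the
  bracket is \<open>2 * p\<close>.\<close>

lemma mid_scaled: "(2 * p) *\<^sub>R C = b *\<^sub>R A + a *\<^sub>R B"
  using nz by (simp add: lambert_mid_def)

lemma inner_AA: "A \<bullet> A = a\<^sup>2" and inner_BB: "B \<bullet> B = b\<^sup>2" and inner_AB: "A \<bullet> B = 2 * p\<^sup>2 - a * b"
  using p_sq by (auto simp: power2_norm_eq_inner)

lemma inner_AC: "A \<bullet> C = a * p"
proof -
  have "2 * p * (A \<bullet> C) = A \<bullet> ((2 * p) *\<^sub>R C)" by simp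
  also have "\<dots> = 2 * p * (a * p)"
    unfolding mid_scaled by (simp add: inner_simps inner_AA inner_AB power2_eq_square algebra_simps)
  finally show ?thesis using nz by simp
qed

lemma inner_BC: "B \<bullet> C = b * p"
proof -
  have "2 * p * (B \<bullet> C) = B \<bullet> ((2 * p) *\<^sub>R C)" by simp
  also have "\<dots> = 2 * p * (b * p)"
    unfolding mid_scaled
    by (simp add: inner_simps inner_BB inner_AB inner_commute[of B A] power2_eq_square algebra_simps)
  finally show ?thesis using nz by simp
qed

lemma inner_CC: "C \<bullet> C = a * b"
proof -
  have "2 * p * (C \<bullet> C) = C \<bullet> ((2 * p) *\<^sub>R C)" by simp
  also have "\<dots> = 2 * p * (a * b)"
    unfolding mid_scaled using inner_AC inner_BC by (simp add: inner_simps inner_commute algebra_simps)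
  finally show ?thesis using nz by simp
qed

lemmas inner_table = inner_AA inner_BB inner_AB inner_AC inner_BC inner_CC
  inner_commute[of B A] inner_commute[of C A] inner_commute[of C B]

lemma N_nonneg: "N x \<ge> 0"
  by (rule lambert_num_nonneg[OF ab_pos(1) p_sq_le])

lemma norm_Q: "norm (Q x) = N x"
proof -
  have "(norm (Q x))\<^sup>2 = (N x)\<^sup>2"
    unfolding power2_norm_eq_inner lambert_quad_def lambert_num_def
    by (simp add: inner_simps inner_table) algebra
  then show ?thesis using N_nonneg by simp
qed

lemma Q_has_derivative:
  "(Q has_vector_derivative 2 *\<^sub>R (x *\<^sub>R B - (1 - x) *\<^sub>R A + (1 - 2 * x) *\<^sub>R C)) (at x within S)"
  unfolding lambert_quad_def
  by (rule has_vector_derivative_eq_rhs)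
     (rule has_vector_derivative_add has_vector_derivative_scaleR has_vector_derivative_const derivative_eq_intros refl
       | simp add: algebra_simps)+
end

locale lambert_family = lambert_endpoints +
  fixes c :: real
  assumes c: "c > -1" and w_pos: "norm A + norm B - 2 * p * c > 0"
begin

abbreviation "D \<equiv> lambert_den c"
abbreviation "w \<equiv> norm A + norm B - 2 * p * c"
abbreviation "tau \<equiv> lambert_time (norm A) (norm B) p c"

definition V :: "real \<Rightarrow> 'a" where
  "V x = 2 *\<^sub>R ((1 - x)\<^sup>2 *\<^sub>R (C - c *\<^sub>R A) + (x * (1 - x)) *\<^sub>R (B - A) + x\<^sup>2 *\<^sub>R (c *\<^sub>R B - C))"

text \<open>The position has \<open>x\<close>-derivative \<open>V x / (D x)\<^sup>2\<close> and time
  has \<open>x\<close>-derivative \<open>sqrt (2 * w) * N x / (D x)\<^sup>2\<close>; the powers of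
  \<open>D\<close> cancel in the quotient.\<close>

definition vel :: "real \<Rightarrow> 'a" where
  "vel x = (1 / (sqrt (2 * w) * N x)) *\<^sub>R V x"

lemma norm_point: "x \<in> {0..1} \<Longrightarrow> norm (lambert_point A B p c x) = N x / D x"
  using lambert_den_pos[OF c, of x] by (simp add: lambert_point_def norm_Q)

lemma point_has_derivative:
  assumes "x \<in> {0..1}"
  shows "(lambert_point A B p c has_vector_derivative (1 / (D x)\<^sup>2) *\<^sub>R V x) (at x within S)"
proof -
  have D: "D x \<noteq> 0" using lambert_den_pos[OF c assms] by simp
  have "((\<lambda>x. 1 / D x) has_real_derivative - (2 * (1 - c) * (2 * x - 1)) / (D x)\<^sup>2) (at x within S)"
    using D by (auto intro!: derivative_eq_intros simp: power2_eq_square)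
  from has_vector_derivative_scaleR[OF this Q_has_derivative]
  have "(lambert_point A B p c has_vector_derivative
     (1 / D x) *\<^sub>R (2 *\<^sub>R (x *\<^sub>R B - (1 - x) *\<^sub>R A + (1 - 2 * x) *\<^sub>R C))
       + (- (2 * (1 - c) * (2 * x - 1)) / (D x)\<^sup>2) *\<^sub>R Q x) (at x within S)"
    by (simp add: lambert_point_def[abs_def])
  moreover have "(1 / D x) *\<^sub>R (2 *\<^sub>R (x *\<^sub>R B - (1 - x) *\<^sub>R A + (1 - 2 * x) *\<^sub>R C))
       + (- (2 * (1 - c) * (2 * x - 1)) / (D x)\<^sup>2) *\<^sub>R Q x
     = (1 / (D x)\<^sup>2) *\<^sub>R (D x *\<^sub>R (2 *\<^sub>R (x *\<^sub>R B - (1 - x) *\<^sub>R A + (1 - 2 * x) *\<^sub>R C))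
       - (2 * (1 - c) * (2 * x - 1)) *\<^sub>R Q x)"
    using D by (simp add: scaleR_diff_right power2_eq_square)
  moreover have "D x *\<^sub>R (2 *\<^sub>R (x *\<^sub>R B - (1 - x) *\<^sub>R A + (1 - 2 * x) *\<^sub>R C))
       - (2 * (1 - c) * (2 * x - 1)) *\<^sub>R Q x = V x"
    unfolding V_def lambert_den_def lambert_quad_def
    by (rule euclidean_eqI) (simp add: inner_simps, algebra)
  ultimately show ?thesis by simp
qed

lemma V_has_derivative:
  "(V has_vector_derivative 2 *\<^sub>R ((- 2 * (1 - x)) *\<^sub>R (C - c *\<^sub>R A) + (1 - 2 * x) *\<^sub>R (B - A)
      + (2 * x) *\<^sub>R (c *\<^sub>R B - C))) (at x within S)"
  unfolding V_def
  by (rule has_vector_derivative_eq_rhs)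
     (rule has_vector_derivative_add has_vector_derivative_scaleR has_vector_derivative_const derivative_eq_intros refl
       | simp add: algebra_simps)+

lemma vel_has_derivative:
  assumes "N x \<noteq> 0"
  shows "(vel has_vector_derivative (- sqrt (2 * w) / (N x)\<^sup>2) *\<^sub>R Q x) (at x within S)"
proof -
  let ?N' = "2 * (x * b - (1 - x) * a + p * (1 - 2 * x))"
  let ?V' = "2 *\<^sub>R ((- 2 * (1 - x)) *\<^sub>R (C - c *\<^sub>R A) + (1 - 2 * x) *\<^sub>R (B - A) + (2 * x) *\<^sub>R (c *\<^sub>R B - C))"
  define k where "k = sqrt (2 * w)"
  have k: "k \<noteq> 0" "k * k = 2 * w" using w_pos by (auto simp: k_def)
  have "((\<lambda>x. 1 / (k * N x)) has_real_derivative - ?N' / (k * (N x)\<^sup>2)) (at x within S)"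
    using assms k by (auto intro!: derivative_eq_intros simp: power2_eq_square field_simps)
  from has_vector_derivative_scaleR[OF this V_has_derivative]
  have "(vel has_vector_derivative (1 / (k * N x)) *\<^sub>R ?V' + (- ?N' / (k * (N x)\<^sup>2)) *\<^sub>R V x) (at x within S)"
    by (simp add: vel_def[abs_def] k_def)
  moreover have "(1 / (k * N x)) *\<^sub>R v + (- n / (k * (N x)\<^sup>2)) *\<^sub>R V x
      = (1 / (k * (N x)\<^sup>2)) *\<^sub>R (N x *\<^sub>R v - n *\<^sub>R V x)" for v n
  proof -
    have "1 / (k * N x) = 1 / (k * (N x)\<^sup>2) * N x" using assms k(1) by (simp add: power2_eq_square)
    then show ?thesis by (simp add: scaleR_diff_right)
  qed
  \<comment> \<open>Newton's equation with all denominators cleared.\<close>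
  moreover have "N x *\<^sub>R ?V' - ?N' *\<^sub>R V x = (- 2 * w) *\<^sub>R Q x"
  proof (rule euclidean_eqI)
    fix e :: 'a assume "e \<in> Basis"
    have "2 * p * (C \<bullet> e) = b * (A \<bullet> e) + a * (B \<bullet> e)"
      using arg_cong[OF mid_scaled, of "\<lambda>v. v \<bullet> e"] by (simp add: inner_simps)
    then show "(N x *\<^sub>R ?V' - ?N' *\<^sub>R V x) \<bullet> e = ((- 2 * w) *\<^sub>R Q x) \<bullet> e"
      unfolding V_def lambert_num_def lambert_quad_def by (simp add: inner_simps) algebra
  qed
  moreover have "(1 / (k * (N x)\<^sup>2)) *\<^sub>R ((- 2 * w) *\<^sub>R Q x) = (- k / (N x)\<^sup>2) *\<^sub>R Q x"
  proof -
    have "1 / (k * (N x)\<^sup>2) * (- (k * k)) = - k / (N x)\<^sup>2" using k(1) by simp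
    moreover have "- 2 * w = - (k * k)" using k(2) by linarith
    ultimately show ?thesis by (simp only: scaleR_scaleR)
  qed
  ultimately show ?thesis by (simp only: k_def)
qed

text \<open>The constant comes from \<open>E / 2 = - \<omega>\<^sup>2\<close>,
  \<open>c = cos (\<omega> S)\<close> and
  \<open>sqrt (2 * w) = sin (\<omega> S) / \<omega>\<close>.\<close>

lemma energy:
  assumes "N x \<noteq> 0" "x \<in> {0..1}"
  shows "norm (vel x) ^ 2 / 2 - 1 / norm (lambert_point A B p c x) = (c\<^sup>2 - 1) / w"
proof -
  have "V x \<bullet> V x = 4 * N x * ((c\<^sup>2 - 1) * N x + w * D x)"
    unfolding V_def lambert_num_def lambert_den_def
    by (simp add: inner_simps inner_table) algebra
  then have v: "(norm (vel x))\<^sup>2 = 4 * N x * ((c\<^sup>2 - 1) * N x + w * D x) / (2 * w * (N x)\<^sup>2)"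
    using w_pos unfolding vel_def power2_norm_eq_inner by (simp add: power2_eq_square)
  have "4 * n * (e * n + u * d) / (2 * u * n\<^sup>2) / 2 - 1 / (n / d) = e / u"
    if "n \<noteq> 0" "u \<noteq> 0" "d \<noteq> 0" for n e u d :: real
    using that by (simp add: field_simps power2_eq_square)
  from this[of "N x" w "D x" "c\<^sup>2 - 1"] show ?thesis
    using assms w_pos lambert_den_pos[OF c assms(2)] unfolding v norm_point[OF assms(2)] by simp
qed

lemma tau_mono: "0 \<le> x \<Longrightarrow> x < y \<Longrightarrow> y \<le> 1 \<Longrightarrow> tau x < tau y"
  by (rule lambert_time_strict_mono[OF c w_pos ab_pos(1) p_sq_le])

lemma tau_inj: "inj_on tau {0..1}"
  by (rule linorder_inj_onI) (use tau_mono in force)+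

lemma continuous_on_tau: "continuous_on {0..1} tau"
  by (rule DERIV_continuous_on[OF lambert_time_has_derivative[OF c]])

lemma tau_image: "tau ` {0..1} = {0..tau 1}"
proof
  show "tau ` {0..1} \<subseteq> {0..tau 1}"
  proof clarify
    fix x :: real assume "x \<in> {0..1}"
    then show "tau x \<in> {0..tau 1}"
      using tau_mono[of 0 x] tau_mono[of x 1] by (cases "x = 0"; cases "x = 1") auto
  qed
  show "{0..tau 1} \<subseteq> tau ` {0..1}"
  proof
    fix y assume "y \<in> {0..tau 1}"
    then have "\<exists>x\<ge>0. x \<le> 1 \<and> tau x = y"
      by (intro IVT') (auto intro: continuous_on_tau)
    then show "y \<in> tau ` {0..1}" by auto
  qed
qed

section \<open>The arc as a function of time\<close>

definition param :: "real \<Rightarrow> real \<Rightarrow> real" where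
  "param t0 t = inv_into {0..1} tau (t - t0)"

definition arc :: "real \<Rightarrow> real \<Rightarrow> 'a" where
  "arc t0 t = lambert_point A B p c (param t0 t)"

lemma param_tau: "x \<in> {0..1} \<Longrightarrow> param t0 (t0 + tau x) = x"
  using tau_inj by (simp add: param_def)

lemma param_in: "t \<in> {t0..t0 + tau 1} \<Longrightarrow> param t0 t \<in> {0..1}"
  unfolding param_def by (rule inv_into_into) (simp add: tau_image)

lemma tau_param: "t \<in> {t0..t0 + tau 1} \<Longrightarrow> t0 + tau (param t0 t) = t"
  unfolding param_def by (subst f_inv_into_f) (simp_all add: tau_image)

lemma shifted_image: "(\<lambda>x. t0 + tau x) ` {0..1} = {t0..t0 + tau 1}"
proof -
  have "(\<lambda>x. t0 + tau x) ` {0..1} = (+) t0 ` (tau ` {0..1})" by (simp add: image_image)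
  then show ?thesis unfolding tau_image by simp
qed

lemma continuous_on_param: "continuous_on {t0..t0 + tau 1} (param t0)"
proof -
  have "continuous_on ((\<lambda>x. t0 + tau x) ` {0..1}) (param t0)"
    by (rule continuous_on_inv) (auto intro!: continuous_intros continuous_on_tau param_tau)
  then show ?thesis by (simp add: shifted_image)
qed

lemma param_has_derivative:
  assumes t: "t \<in> {t0..t0 + tau 1}" and N: "N (param t0 t) \<noteq> 0"
  shows "(param t0 has_real_derivative (D (param t0 t))\<^sup>2 / (sqrt (2 * w) * N (param t0 t))) (at t within {t0..t0 + tau 1})"
proof -
  let ?x = "param t0 t"
  define d where "d = sqrt (2 * w) * (N ?x / (D ?x)\<^sup>2)"
  have x: "?x \<in> {0..1}" by (rule param_in[OF t])
  have d: "d \<noteq> 0" using N w_pos lambert_den_pos[OF c x] by (simp add: d_def)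
  have "(param t0 has_derivative (\<lambda>h. h / d)) (at (t0 + tau ?x) within (\<lambda>x. t0 + tau x) ` {0..1})"
  proof (rule has_derivative_inverse_within)
    show "((\<lambda>x. t0 + tau x) has_derivative (\<lambda>h. d * h)) (at ?x within {0..1})"
      using DERIV_add[OF DERIV_const lambert_time_has_derivative[OF c x, of a b p], of t0]
      unfolding d_def has_field_derivative_def by (simp only: add_0)
    show "continuous (at (t0 + tau ?x) within (\<lambda>x. t0 + tau x) ` {0..1}) (param t0)"
      using continuous_on_param t unfolding shifted_image tau_param[OF t]
      by (simp add: continuous_on_eq_continuous_within)
    show "linear (\<lambda>h. h / d)" by (rule bounded_linear.linear[OF bounded_linear_divide])
  qed (use x d param_tau in auto)
  then have "(param t0 has_real_derivative 1 / d) (at t within {t0..t0 + tau 1})"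
    unfolding shifted_image tau_param[OF t] has_field_derivative_def by (simp add: mult.commute[of "1 / d", abs_def])
  then show ?thesis by (simp add: d_def)
qed

lemma arc_zero_iff: "t \<in> {t0..t0 + tau 1} \<Longrightarrow> arc t0 t = 0 \<longleftrightarrow> N (param t0 t) = 0"
  using norm_point[OF param_in, of t t0] lambert_den_pos[OF c param_in, of t t0]
    norm_eq_zero[of "lambert_point A B p c (param t0 t)"]
  by (simp only: arc_def) auto

lemma arc_has_derivative:
  assumes t: "t \<in> {t0..t0 + tau 1}" and N: "N (param t0 t) \<noteq> 0"
  shows "(arc t0 has_vector_derivative vel (param t0 t)) (at t within {t0..t0 + tau 1})"
proof -
  let ?x = "param t0 t" and ?d = "(D (param t0 t))\<^sup>2 / (sqrt (2 * w) * N (param t0 t))"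
  have "D ?x \<noteq> 0" using lambert_den_pos[OF c param_in[OF t]] by simp
  then have "?d *\<^sub>R ((1 / (D ?x)\<^sup>2) *\<^sub>R V ?x) = vel ?x"
    by (simp add: vel_def)
  moreover have "((lambert_point A B p c \<circ> param t0) has_vector_derivative ?d *\<^sub>R ((1 / (D ?x)\<^sup>2) *\<^sub>R V ?x)) (at t within {t0..t0 + tau 1})"
    using param_has_derivative[OF assms] point_has_derivative[OF param_in[OF t]]
    by (intro vector_diff_chain_within) (simp_all add: has_real_derivative_iff_has_vector_derivative)
  ultimately show ?thesis by (simp add: arc_def[abs_def] o_def)
qed

lemma arc_vel_has_derivative:
  assumes t: "t \<in> {t0..t0 + tau 1}" and N: "N (param t0 t) \<noteq> 0"
  shows "((\<lambda>t. vel (param t0 t)) has_vector_derivative (- (1 / norm (arc t0 t) ^ 3)) *\<^sub>R arc t0 t) (at t within {t0..t0 + tau 1})"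
proof -
  let ?x = "param t0 t" and ?d = "(D (param t0 t))\<^sup>2 / (sqrt (2 * w) * N (param t0 t))"
  have D: "D ?x \<noteq> 0" using lambert_den_pos[OF c param_in[OF t]] by simp
  have "?d * (- sqrt (2 * w) / (N ?x)\<^sup>2) = - (1 / (N ?x / D ?x) ^ 3) * (1 / D ?x)"
    using D N w_pos by (simp add: field_simps power2_eq_square power3_eq_cube)
  then have "?d *\<^sub>R ((- sqrt (2 * w) / (N ?x)\<^sup>2) *\<^sub>R Q ?x) = (- (1 / norm (arc t0 t) ^ 3)) *\<^sub>R arc t0 t"
    unfolding arc_def norm_point[OF param_in[OF t]] by (simp only: lambert_point_def scaleR_scaleR)
  moreover have "((vel \<circ> param t0) has_vector_derivative ?d *\<^sub>R ((- sqrt (2 * w) / (N ?x)\<^sup>2) *\<^sub>R Q ?x)) (at t within {t0..t0 + tau 1})"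
    using param_has_derivative[OF assms] vel_has_derivative[OF N]
    by (intro vector_diff_chain_within) (simp_all add: has_real_derivative_iff_has_vector_derivative)
  ultimately show ?thesis by (simp add: o_def)
qed

lemma param_endpoints: "param t0 t0 = 0" "param t0 (t0 + tau 1) = 1"
  using param_tau[of 0 t0] param_tau[of 1 t0] by auto

lemma arc_endpoints: "arc t0 t0 = A" "arc t0 (t0 + tau 1) = B"
  by (simp_all add: arc_def param_endpoints lambert_point_def lambert_quad_def lambert_den_def)

lemma tau_1_pos: "tau 1 > 0"
  using tau_mono[of 0 1] by simp

text \<open>Under this hypothesis \<open>\<beta>\<close> is a real multiple of
  \<open>\<alpha>\<close>, so \<open>(1 - x) \<alpha> + x \<beta>\<close> stays on a real line and
  its square on the ray of \<open>A\<close>. This supplies the ray demanded at collisions, which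
  occur in no other case.\<close>

lemma aligned:
  assumes "p\<^sup>2 = a * b" shows "Q x = (N x / a) *\<^sub>R A"
proof -
  have AB: "A \<bullet> B = a * b" using assms p_sq by simp
  then have B: "a *\<^sub>R B = b *\<^sub>R A" by (simp add: norm_cauchy_schwarz_eq)
  have "a *\<^sub>R Q x = N x *\<^sub>R A"
  proof (rule euclidean_eqI)
    fix e :: 'a assume "e \<in> Basis"
    have 1: "a * (B \<bullet> e) = b * (A \<bullet> e)" using arg_cong[OF B, of "\<lambda>v. v \<bullet> e"] by simp
    have "2 * p * (C \<bullet> e) = b * (A \<bullet> e) + a * (B \<bullet> e)"
      using arg_cong[OF mid_scaled, of "\<lambda>v. v \<bullet> e"] by (simp add: inner_simps)
    then have "2 * p * (a * (C \<bullet> e)) = 2 * p * (p * (A \<bullet> e))" using 1 assms by algebra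
    then have 2: "a * (C \<bullet> e) = p * (A \<bullet> e)" using nz by simp
    show "(a *\<^sub>R Q x) \<bullet> e = (N x *\<^sub>R A) \<bullet> e"
      using 1 2 unfolding lambert_quad_def lambert_num_def by (simp add: inner_simps) algebra
  qed
  then have "(1 / a) *\<^sub>R (a *\<^sub>R Q x) = (1 / a) *\<^sub>R (N x *\<^sub>R A)" by simp
  then show ?thesis using ab_pos nz by simp
qed

lemma kepler_arc_arc: "kepler_arc 0 (arc t0) t0 (t0 + tau 1)"
  unfolding kepler_arc_def
proof (intro conjI ballI impI)
  have "continuous_on {0..1} (lambert_point A B p c)"
    by (intro continuous_at_imp_continuous_on ballI has_vector_derivative_continuous[OF point_has_derivative])
  then have "continuous_on (param t0 ` {t0..t0 + tau 1}) (lambert_point A B p c)"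
    by (rule continuous_on_subset) (use param_in in blast)
  then show "continuous_on {t0..t0 + tau 1} (arc t0)"
    unfolding arc_def[abs_def] by (rule continuous_on_compose2[OF _ continuous_on_param]) simp
  have "{t \<in> {t0..t0 + tau 1}. arc t0 t = 0} \<subseteq> (\<lambda>x. t0 + tau x) ` {x. N x = 0}"
    using arc_zero_iff tau_param by (auto simp: image_iff) metis
  then show "finite {t \<in> {t0..t0 + tau 1}. arc t0 t = 0}"
    using finite_lambert_num_zeros[OF ab_pos(1) p_sq_le] finite_surj by blast
  show "\<exists>v E. \<forall>t\<in>{t0..t0 + tau 1}. arc t0 t \<noteq> 0 \<longrightarrow>
          (arc t0 has_vector_derivative v t) (at t within {t0..t0 + tau 1}) \<and>
          (v has_vector_derivative (- (1 / norm (arc t0 t - 0) ^ 3)) *\<^sub>R (arc t0 t - 0)) (at t within {t0..t0 + tau 1}) \<and>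
          norm (v t) ^ 2 / 2 - 1 / norm (arc t0 t - 0) = E"
    using arc_has_derivative arc_vel_has_derivative energy[OF _ param_in] arc_zero_iff
    by (intro exI[of _ "\<lambda>t. vel (param t0 t)"] exI[of _ "(c\<^sup>2 - 1) / w"]) (auto simp: arc_def)
  fix s assume s: "s \<in> {t0..t0 + tau 1}" "arc t0 s = 0"
  then have "N (param t0 s) = 0" using arc_zero_iff by simp
  then have al: "p\<^sup>2 = a * b" using lambert_num_eq_0D(1)[OF ab_pos(1) p_sq_le] by blast
  have "arc t0 t = 0 + (N (param t0 t) / (D (param t0 t) * a)) *\<^sub>R A \<and> N (param t0 t) / (D (param t0 t) * a) \<ge> 0"
    if "t \<in> {t0..t0 + tau 1}" for t
    using lambert_den_pos[OF c param_in[OF that]] N_nonneg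
    by (simp add: arc_def lambert_point_def aligned[OF al])
  then show "\<exists>u e. e > 0 \<and> (\<forall>t\<in>{t0..t0 + tau 1}. \<bar>t - s\<bar> < e \<longrightarrow> (\<exists>r\<ge>0. arc t0 t = 0 + r *\<^sub>R u))"
    by (intro exI[of _ A] exI[of _ 1]) (use zero_less_one in blast)
qed (use tau_1_pos in simp)

text \<open>For \<open>p > 0\<close> the angle between \<open>\<alpha>\<close> and
  \<open>\<beta>\<close> is acute, so the direction of the moving square stays less than a right
  angle away from \<open>\<alpha> \<beta>\<close>. The half-space with normal \<open>C\<close>
  therefore separates the arc from the centre.\<close>

lemma inner_mid_pos:
  assumes "p > 0" "x \<in> {0..1}" shows "C \<bullet> lambert_point A B p c x > 0"
proof -
  have "C \<bullet> Q x = (1 - x)\<^sup>2 * (a * p) + x\<^sup>2 * (b * p) + 2 * x * (1 - x) * (a * b)"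
    by (simp add: lambert_quad_def inner_simps inner_table)
  also have "\<dots> > 0"
  proof (cases "x = 0")
    case True then show ?thesis using ab_pos assms by simp
  next
    case False
    then show ?thesis using ab_pos assms
      by (intro add_pos_nonneg add_nonneg_pos mult_pos_pos mult_nonneg_nonneg) auto
  qed
  finally show ?thesis using lambert_den_pos[OF c assms(2)] by (simp add: lambert_point_def)
qed

lemma arc_direct:
  assumes "p > 0" "\<And>t. t \<in> S \<Longrightarrow> \<exists>x\<in>{0..1}. q t = lambert_point A B p c x"
  shows "0 \<notin> convex hull (q ` S)"
proof -
  have "convex hull (q ` S) \<subseteq> {v. C \<bullet> v > 0}"
  proof (rule hull_minimal)
    show "q ` S \<subseteq> {v. C \<bullet> v > 0}" using inner_mid_pos[OF assms(1)] assms(2) by force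
  qed (rule convex_halfspace_gt)
  then show ?thesis by auto
qed

lemma arc_indirect:
  assumes "p < 0" shows "0 \<in> convex hull (arc t0 ` {t0..t0 + tau 1})"
proof -
  \<comment> \<open>Here \<open>(1 - x) \<alpha> + x \<beta>\<close> is orthogonal to
    \<open>\<alpha>\<close>. Its square is then a nonnegative multiple of \<open>- A\<close>, so the
    centre lies between that point of the arc and \<open>A\<close>.\<close>
  define x where "x = a / (a - p)"
  have ap: "a - p > 0" using assms ab_pos by linarith
  have x: "x \<in> {0..1}" "x > 0" using ap ab_pos(1) assms
    by (auto simp: x_def divide_le_eq simp del: zero_less_norm_iff intro!: divide_nonneg_pos)
  have x1: "(1 - x) * a + p * x = 0"
  proof -
    have "x * (a - p) = a" using ap by (simp add: x_def)
    then show ?thesis by (simp add: algebra_simps)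
  qed
  let ?X = "lambert_point A B p c x"
  have AC: "(- p * D x) *\<^sub>R ?X = (x * (1 - x) * b + p * (1 - x)\<^sup>2) *\<^sub>R (- A)"
  proof -
    have D: "D x \<noteq> 0" using lambert_den_pos[OF c x(1)] by simp
    have "(- p * D x) *\<^sub>R ?X = (- p) *\<^sub>R Q x" using D by (simp add: lambert_point_def)
    also have "\<dots> = (x * (1 - x) * b + p * (1 - x)\<^sup>2) *\<^sub>R (- A)"
    proof (rule euclidean_eqI)
      fix e :: 'a assume "e \<in> Basis"
      have "2 * p * (C \<bullet> e) = b * (A \<bullet> e) + a * (B \<bullet> e)"
        using arg_cong[OF mid_scaled, of "\<lambda>v. v \<bullet> e"] by (simp add: inner_simps)
      then show "((- p) *\<^sub>R Q x) \<bullet> e = ((x * (1 - x) * b + p * (1 - x)\<^sup>2) *\<^sub>R (- A)) \<bullet> e"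
        using x1 unfolding lambert_quad_def by (simp add: inner_simps) algebra
    qed
    finally show ?thesis .
  qed
  define k where "k = x * (1 - x) * b + p * (1 - x)\<^sup>2"
  have "a * k = (1 - x) * x * (a * b - p\<^sup>2)" using x1 unfolding k_def by algebra
  also have "\<dots> \<ge> 0" using x p_sq_le by (intro mult_nonneg_nonneg) auto
  finally have k: "k \<ge> 0" using ab_pos by (simp add: zero_le_mult_iff)
  define l where "l = - p * D x"
  have l: "l > 0" using assms lambert_den_pos[OF c x(1)] by (simp add: l_def mult_neg_pos)
  have "l *\<^sub>R ?X + k *\<^sub>R A = 0" using AC by (simp add: l_def k_def)
  then have "(1 / (l + k)) *\<^sub>R (l *\<^sub>R ?X + k *\<^sub>R A) = 0" by simp
  then have "(l / (l + k)) *\<^sub>R ?X + (k / (l + k)) *\<^sub>R A = 0"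
    by (simp add: scaleR_add_right)
  moreover have "(l / (l + k)) *\<^sub>R ?X + (k / (l + k)) *\<^sub>R A \<in> convex hull (arc t0 ` {t0..t0 + tau 1})"
  proof (rule convexD[OF convex_convex_hull])
    show "A \<in> convex hull (arc t0 ` {t0..t0 + tau 1})"
      using arc_endpoints(1)[of t0] tau_1_pos by (intro hull_inc) (auto simp: image_iff intro!: bexI[of _ t0])
    have "?X = arc t0 (t0 + tau x)" by (simp add: arc_def param_tau[OF x(1)])
    moreover have "t0 + tau x \<in> {t0..t0 + tau 1}" using shifted_image x(1) by blast
    ultimately show "?X \<in> convex hull (arc t0 ` {t0..t0 + tau 1})" by (intro hull_inc) blast
  qed (use k l in \<open>auto simp: add_divide_distrib[symmetric]\<close>)
  ultimately show ?thesis by simp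
qed

text \<open>A return to \<open>A\<close> is an equality case of Cauchy-Schwarz and forces
  \<open>p\<^sup>2 = a * b\<close>, a rectilinear motion. On the line, equal distance and equal
  velocity then give \<open>a = b\<close>, hence \<open>A = B\<close>.\<close>

lemma arc_no_return:
  assumes x: "0 < x" "x < 1" and pt: "lambert_point A B p c x = A" and v: "vel x = vel 0"
  shows False
proof -
  have D: "D x > 0" using lambert_den_pos[OF c] x by simp
  have "D x *\<^sub>R lambert_point A B p c x = Q x" using D by (simp add: lambert_point_def)
  then have Q: "Q x = D x *\<^sub>R A" unfolding pt by simp
  then have Nx: "N x = D x * a" using norm_Q[of x] D by simp
  have "A \<bullet> Q x = D x * a\<^sup>2" unfolding Q by (simp add: inner_AA)
  then have "(1 - x)\<^sup>2 * a\<^sup>2 + x\<^sup>2 * (2 * p\<^sup>2 - a * b) + 2 * x * (1 - x) * (a * p) = D x * a\<^sup>2"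
    by (simp add: lambert_quad_def inner_simps inner_table)
  then have "x\<^sup>2 * (2 * (p\<^sup>2 - a * b)) = 0" using Nx unfolding lambert_num_def by algebra
  then have pab: "p\<^sup>2 = a * b" using x by simp
  have AV: "A \<bullet> V y = 2 * a * ((1 - y)\<^sup>2 * (p - c * a) + y * (1 - y) * (b - a) + y\<^sup>2 * (c * b - p))" for y
  proof -
    have "A \<bullet> B = a * b" using inner_AB pab by simp
    then show ?thesis
      unfolding V_def by (simp add: inner_simps inner_AA inner_AC power2_eq_square algebra_simps)
  qed
  have s: "sqrt (2 * w) \<noteq> 0" using w_pos by simp
  have "A \<bullet> vel x = A \<bullet> vel 0" by (simp add: v)
  then have "(A \<bullet> V x) / (sqrt (2 * w) * (D x * a)) = (A \<bullet> V 0) / (sqrt (2 * w) * a)"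
    using Nx by (simp add: vel_def lambert_num_def)
  then have "A \<bullet> V x = D x * (A \<bullet> V 0)"
    using s ab_pos D by (simp add: field_simps)
  then have e1: "(1 - x)\<^sup>2 * (p - c * a) + x * (1 - x) * (b - a) + x\<^sup>2 * (c * b - p) = D x * (p - c * a)"
    unfolding AV using ab_pos by simp
  have "x * (x * (b - a) + 2 * (1 - x) * (p - c * a)) = 0"
    using Nx unfolding lambert_num_def lambert_den_def by algebra
  then have e2: "x * (b - a) + 2 * (1 - x) * (p - c * a) = 0" using x by simp
  have "x * (D x * (b - a)) = 0" using e1 e2 unfolding lambert_den_def by algebra
  then have "b = a" using x D by simp
  then have "(A - B) \<bullet> (A - B) = 0"
    using pab by (simp add: inner_diff inner_table power2_eq_square)
  then show False using nz by simp
qed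

lemma arc_not_multi_revolution: "\<not> multi_revolution 0 (arc t0) t0 (t0 + tau 1)"
proof
  assume "multi_revolution 0 (arc t0) t0 (t0 + tau 1)"
  then obtain P where P: "P > 0" "P < tau 1"
    and per: "\<And>t. t \<in> {t0..t0 + tau 1 - P} \<Longrightarrow> arc t0 (t + P) = arc t0 t"
    unfolding multi_revolution_def by auto
  let ?I = "{t0..t0 + tau 1 - P}"
  define x where "x = param t0 (t0 + P)"
  have tP: "t0 + P \<in> {t0..t0 + tau 1}" using P by simp
  have x01: "x \<in> {0..1}" using param_in[OF tP] by (simp add: x_def)
  have taux: "tau x = P" using tau_param[OF tP] by (simp add: x_def)
  have x: "0 < x" "x < 1" using x01 taux P lambert_time_0[of a b p c] by (auto simp: less_le)
  have pt: "lambert_point A B p c x = A"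
    using per[of t0] P arc_endpoints(1) by (simp add: arc_def x_def)
  then have "arc t0 (t0 + P) \<noteq> 0" using nz by (simp add: arc_def x_def)
  then have Nx: "N (param t0 (t0 + P)) \<noteq> 0" using arc_zero_iff tP by blast
  \<comment> \<open>Periodicity is known only on \<open>?I\<close>, so both velocities at
    \<open>t0\<close> are derivatives within \<open>?I\<close>; as \<open>P < tau 1\<close>,
    \<open>t0\<close> is a limit point of it.\<close>
  have "((arc t0 \<circ> (\<lambda>t. t + P)) has_vector_derivative 1 *\<^sub>R vel x) (at t0 within ?I)"
  proof (rule vector_diff_chain_within)
    show "((\<lambda>t. t + P) has_vector_derivative 1) (at t0 within ?I)"
      by (auto intro!: derivative_eq_intros simp flip: has_real_derivative_iff_has_vector_derivative)
    show "(arc t0 has_vector_derivative vel x) (at (t0 + P) within (\<lambda>t. t + P) ` ?I)"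
      using has_vector_derivative_within_subset[OF arc_has_derivative[OF tP Nx]] P
      by (fastforce simp: x_def)
  qed
  then have d1: "(arc t0 has_vector_derivative vel x) (at t0 within ?I)"
    using has_vector_derivative_transform[of t0 ?I "arc t0" "arc t0 \<circ> (\<lambda>t. t + P)" "vel x"] per P by simp
  have "(arc t0 has_vector_derivative vel 0) (at t0 within {t0..t0 + tau 1})"
    using arc_has_derivative[of t0 t0] ab_pos tau_1_pos by (simp add: param_endpoints lambert_num_def)
  then have d2: "(arc t0 has_vector_derivative vel 0) (at t0 within ?I)"
    by (rule has_vector_derivative_within_subset) (use P in auto)
  have "vel x = vel 0"
    by (rule vector_derivative_unique_within[OF _ d1 d2]) (use P in \<open>simp add: trivial_limit_within\<close>)
  then show False using arc_no_return[OF x pt] by simp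
qed

end

section \<open>Regularization of an arbitrary arc\<close>

text \<open>\<open>kcos k\<close> and \<open>ksin k\<close> solve \<open>f'' = k f\<close> with
  initial values 1, 0 and 0, 1 for \<open>f\<close>, \<open>f'\<close>. One pair for all signs of
  the energy spares the evolution formulas a case distinction.\<close>

definition kcos :: "real \<Rightarrow> real \<Rightarrow> real" where
  "kcos k s = (if k < 0 then cos (sqrt (- k) * s) else cosh (sqrt k * s))"

definition ksin :: "real \<Rightarrow> real \<Rightarrow> real" where
  "ksin k s = (if k < 0 then sin (sqrt (- k) * s) / sqrt (- k)
             else if k = 0 then s else sinh (sqrt k * s) / sqrt k)"

lemma kcos_0 [simp]: "kcos k 0 = 1" and ksin_0 [simp]: "ksin k 0 = 0"
  by (simp_all add: kcos_def ksin_def)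

lemma kcos_has_derivative: "(kcos k has_real_derivative k * ksin k s) (at s)"
proof (cases k "0 :: real" rule: linorder_cases)
  case less
  then have kk: "sqrt (- k) * (sqrt (- k) * z) = - k * z" for z by (simp flip: mult.assoc)
  show ?thesis using less unfolding kcos_def[abs_def] ksin_def
    by (auto intro!: derivative_eq_intros simp: field_simps kk)
next
  case equal
  then show ?thesis by (simp add: kcos_def[abs_def])
next
  case greater
  then have kk: "sqrt k * (sqrt k * z) = k * z" for z by (simp flip: mult.assoc)
  show ?thesis using greater unfolding kcos_def[abs_def] ksin_def
    by (auto intro!: derivative_eq_intros simp: field_simps kk)
qed

lemma ksin_has_derivative: "(ksin k has_real_derivative kcos k s) (at s)"
  by (cases k "0 :: real" rule: linorder_cases)
     (auto simp: kcos_def ksin_def[abs_def] mult.assoc intro!: derivative_eq_intros)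

lemma kcos_ksin_pythagoras: "(kcos k s)\<^sup>2 - k * (ksin k s)\<^sup>2 = 1"
  by (cases k "0 :: real" rule: linorder_cases)
     (auto simp: kcos_def ksin_def power_divide cosh_square_eq)

lemma ksin_diff: "ksin k (u - s) = ksin k u * kcos k s - kcos k u * ksin k s"
  by (auto simp: kcos_def ksin_def right_diff_distrib sin_diff sinh_diff diff_divide_distrib)

lemma kcos_diff: "kcos k (u - s) = kcos k u * kcos k s - k * ksin k u * ksin k s"
proof (cases k "0 :: real" rule: linorder_cases)
  case less
  then have kk: "sqrt (- k) * (sqrt (- k) * z) = - k * z" for z by (simp flip: mult.assoc)
  show ?thesis using less
    by (simp add: kcos_def ksin_def right_diff_distrib cos_diff field_simps kk)
next
  case greater
  then have kk: "sqrt k * (sqrt k * z) = k * z" for z by (simp flip: mult.assoc)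
  show ?thesis using greater
    by (simp add: kcos_def ksin_def right_diff_distrib cosh_diff field_simps kk)
qed (simp add: kcos_def)

lemma ksin_pos:
  assumes "0 < s" "k < 0 \<Longrightarrow> sqrt (- k) * s < pi"
  shows "ksin k s > 0"
  using assms by (cases k "0 :: real" rule: linorder_cases) (auto simp: ksin_def intro!: divide_pos_pos sin_gt_zero)

lemma kcos_gt_minus_1:
  assumes "0 < s" "k < 0 \<Longrightarrow> sqrt (- k) * s < pi"
  shows "kcos k s > -1"
proof (cases "k < 0")
  case True
  then have "cos pi < cos (sqrt (- k) * s)"
    using assms by (intro cos_monotone_0_pi) auto
  then show ?thesis using True by (simp add: kcos_def)
next
  case False
  then show ?thesis using cosh_real_ge_1[of "sqrt k * s"] by (simp add: kcos_def)
qed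

text \<open>The squared norm of \<open>norm Y *\<^sub>R X + norm X *\<^sub>R Y\<close> contains the
  factor assumed to be 0; dividing this vector by \<open>norm X + norm Y\<close> gives the convex
  combination. \<open>Y = 0\<close> is allowed, so a collision counts as opposite.\<close>

lemma zero_in_segment_if_opposite:
  fixes X Y :: "'a::real_inner"
  assumes "X \<noteq> 0" "norm X * norm Y + X \<bullet> Y = 0"
  shows "0 \<in> closed_segment X Y"
proof -
  define l where "l = norm X / (norm X + norm Y)"
  have "norm X > 0" using assms by simp
  then have s: "norm X + norm Y > 0" by (simp add: add_pos_nonneg)
  have "(norm (norm Y *\<^sub>R X + norm X *\<^sub>R Y))\<^sup>2 = 2 * norm X * norm Y * (norm X * norm Y + X \<bullet> Y)"
    unfolding power2_norm_eq_inner
    by (simp add: inner_simps inner_commute[of Y X] dot_square_norm[of X] dot_square_norm[of Y]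
        power2_eq_square algebra_simps)
  then have "norm Y *\<^sub>R X + norm X *\<^sub>R Y = 0" using assms by simp
  then have "(1 / (norm X + norm Y)) *\<^sub>R (norm Y *\<^sub>R X + norm X *\<^sub>R Y) = 0" by simp
  moreover have "1 - l = norm Y / (norm X + norm Y)" using s by (simp add: l_def field_simps)
  ultimately have "(1 - l) *\<^sub>R X + l *\<^sub>R Y = 0" by (simp add: l_def scaleR_add_right)
  moreover have "0 \<le> l" "l \<le> 1" using s by (auto simp: l_def)
  ultimately show ?thesis by (auto simp: closed_segment_def)
qed

lemma norm_has_real_derivative:
  fixes q :: "real \<Rightarrow> 'a::real_inner"
  assumes "(q has_vector_derivative v) (at t within S)" "q t \<noteq> 0"
  shows "((\<lambda>t. norm (q t)) has_real_derivative (q t \<bullet> v) / norm (q t)) (at t within S)"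
proof -
  have "((\<lambda>t. q t \<bullet> q t) has_real_derivative q t \<bullet> v + v \<bullet> q t) (at t within S)"
    using bounded_bilinear.has_vector_derivative[OF bounded_bilinear_inner assms(1) assms(1)]
    by (simp add: has_real_derivative_iff_has_vector_derivative)
  moreover have "q t \<bullet> q t > 0" using assms by simp
  ultimately have "((\<lambda>t. sqrt (q t \<bullet> q t)) has_real_derivative
      inverse (sqrt (q t \<bullet> q t)) / 2 * (q t \<bullet> v + v \<bullet> q t)) (at t within S)"
    by (intro DERIV_chain2[OF DERIV_real_sqrt])
  then show ?thesis by (simp add: norm_eq_sqrt_inner inner_commute field_simps)
qed

section \<open>Motion with conserved energy and Laplace vector\<close>

locale kepler_motion =
  fixes q v :: "real \<Rightarrow> 'a::euclidean_space" and t0 t1 E :: real and e :: 'a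
  assumes t01: "t0 < t1" and cont_q: "continuous_on {t0..t1} q"
    and finite_collisions: "finite {t \<in> {t0..t1}. q t = 0}"
    and start: "q t0 \<noteq> 0"
    and q_deriv: "t \<in> {t0..t1} \<Longrightarrow> q t \<noteq> 0 \<Longrightarrow> (q has_vector_derivative v t) (at t within {t0..t1})"
    and v_deriv: "t \<in> {t0..t1} \<Longrightarrow> q t \<noteq> 0 \<Longrightarrow>
       (v has_vector_derivative (- (1 / norm (q t) ^ 3)) *\<^sub>R q t) (at t within {t0..t1})"
    and energy: "t \<in> {t0..t1} \<Longrightarrow> q t \<noteq> 0 \<Longrightarrow> (norm (v t))\<^sup>2 / 2 - 1 / norm (q t) = E"
    and laplace: "t \<in> {t0..t1} \<Longrightarrow> q t \<noteq> 0 \<Longrightarrow>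
       (norm (v t))\<^sup>2 *\<^sub>R q t - (q t \<bullet> v t) *\<^sub>R v t - (1 / norm (q t)) *\<^sub>R q t = e"

lemma laplace_deriv_zero:
  fixes q v :: "real \<Rightarrow> 'a::euclidean_space"
  assumes q: "(q has_vector_derivative v t) (at t within S)" and nz: "q t \<noteq> 0"
    and v: "(v has_vector_derivative (- (1 / norm (q t) ^ 3)) *\<^sub>R q t) (at t within S)"
  shows "((\<lambda>t. (norm (v t))\<^sup>2 *\<^sub>R q t - (q t \<bullet> v t) *\<^sub>R v t - (1 / norm (q t)) *\<^sub>R q t)
           has_vector_derivative 0) (at t within S)"
proof -
  define r i where "r = norm (q t)" and "i = 1 / norm (q t)"
  have ri: "r * i = 1" "i \<noteq> 0" and r2: "q t \<bullet> q t = r\<^sup>2" using nz by (auto simp: r_def i_def power2_norm_eq_inner)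
  have v': "(v has_vector_derivative (- (i ^ 3)) *\<^sub>R q t) (at t within S)"
    using v by (simp add: i_def power_one_over)
  have vv: "((\<lambda>t. (norm (v t))\<^sup>2) has_real_derivative 2 * (- (i ^ 3) * (q t \<bullet> v t))) (at t within S)"
    using bounded_bilinear.has_vector_derivative[OF bounded_bilinear_inner v' v']
    unfolding has_real_derivative_iff_has_vector_derivative power2_norm_eq_inner
    by (simp add: inner_commute mult_ac)
  have qv: "((\<lambda>t. q t \<bullet> v t) has_real_derivative - (i ^ 3) * r\<^sup>2 + (norm (v t))\<^sup>2) (at t within S)"
    using bounded_bilinear.has_vector_derivative[OF bounded_bilinear_inner q v']
    unfolding has_real_derivative_iff_has_vector_derivative power2_norm_eq_inner
    by (simp add: r2)
  have "((\<lambda>t. 1 / norm (q t)) has_real_derivative - ((q t \<bullet> v t) / norm (q t)) / (norm (q t))\<^sup>2) (at t within S)"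
    using nz by (auto intro!: derivative_eq_intros norm_has_real_derivative[OF q] simp: power2_eq_square)
  then have ir: "((\<lambda>t. 1 / norm (q t)) has_real_derivative - ((q t \<bullet> v t) * i ^ 3)) (at t within S)"
    using nz by (simp add: i_def power3_eq_cube power2_eq_square mult.assoc)
  have D: "((\<lambda>t. (norm (v t))\<^sup>2 *\<^sub>R q t - (q t \<bullet> v t) *\<^sub>R v t - (1 / norm (q t)) *\<^sub>R q t)
      has_vector_derivative
        ((norm (v t))\<^sup>2 *\<^sub>R v t + (2 * (- (i ^ 3) * (q t \<bullet> v t))) *\<^sub>R q t)
      - ((q t \<bullet> v t) *\<^sub>R ((- (i ^ 3)) *\<^sub>R q t) + (- (i ^ 3) * r\<^sup>2 + (norm (v t))\<^sup>2) *\<^sub>R v t)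
      - ((1 / norm (q t)) *\<^sub>R v t + (- ((q t \<bullet> v t) * i ^ 3)) *\<^sub>R q t)) (at t within S)"
    by (intro has_vector_derivative_diff has_vector_derivative_scaleR vv qv ir q v')
  have i1: "i ^ 3 * r\<^sup>2 = i" using ri(1) by algebra
  have "((norm (v t))\<^sup>2 *\<^sub>R v t + (2 * (- (i ^ 3) * (q t \<bullet> v t))) *\<^sub>R q t)
      - ((q t \<bullet> v t) *\<^sub>R ((- (i ^ 3)) *\<^sub>R q t) + (- (i ^ 3) * r\<^sup>2 + (norm (v t))\<^sup>2) *\<^sub>R v t)
      - ((1 / norm (q t)) *\<^sub>R v t + (- ((q t \<bullet> v t) * i ^ 3)) *\<^sub>R q t) = 0"
    using i1 unfolding i_def[symmetric]
    by (simp add: algebra_simps flip: scaleR_2)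
  then show ?thesis using D by simp
qed

text \<open>Between collisions the Laplace vector is constant because of the equation of motion.
  Near a collision position and velocity are parallel to the ray direction \<open>u\<close>, which
  reduces the vector to \<open>- sgn u\<close>, the same on both sides.\<close>

lemma kepler_arc_imp_motion:
  fixes q :: "real \<Rightarrow> 'a::euclidean_space"
  assumes arc: "kepler_arc 0 q t0 t1" and start: "q t0 \<noteq> 0"
  obtains v E e where "kepler_motion q v t0 t1 E e"
proof -
  let ?I = "{t0..t1}" and ?K = "{t \<in> {t0..t1}. q t = 0}"
  have t01: "t0 < t1" and cq: "continuous_on ?I q" and fin: "finite ?K"
    and ray: "\<And>s. s \<in> ?I \<Longrightarrow> q s = 0 \<Longrightarrow> \<exists>u d. d > 0 \<and> (\<forall>t\<in>?I. \<bar>t - s\<bar> < d \<longrightarrow> (\<exists>r\<ge>0. q t = r *\<^sub>R u))"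
    using arc unfolding kepler_arc_def by auto
  from arc obtain v E where vE: "\<forall>t\<in>?I. q t \<noteq> 0 \<longrightarrow>
          (q has_vector_derivative v t) (at t within ?I) \<and>
          (v has_vector_derivative (- (1 / norm (q t - 0) ^ 3)) *\<^sub>R (q t - 0)) (at t within ?I) \<and>
          norm (v t) ^ 2 / 2 - 1 / norm (q t - 0) = E"
    unfolding kepler_arc_def by blast
  have qd: "(q has_vector_derivative v t) (at t within ?I)"
    and vd: "(v has_vector_derivative (- (1 / norm (q t) ^ 3)) *\<^sub>R q t) (at t within ?I)"
    and en: "(norm (v t))\<^sup>2 / 2 - 1 / norm (q t) = E" if "t \<in> ?I" "q t \<noteq> 0" for t
    using bspec[OF vE that(1)] that(2) by auto
  define f where "f = (\<lambda>t. (norm (v t))\<^sup>2 *\<^sub>R q t - (q t \<bullet> v t) *\<^sub>R v t - (1 / norm (q t)) *\<^sub>R q t)"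
  have isol: "\<exists>d>0. \<forall>t\<in>?I. t \<noteq> s \<and> \<bar>t - s\<bar> < d \<longrightarrow> q t \<noteq> 0" for s
  proof -
    obtain d where "d > 0" "\<forall>x\<in>?K. x \<noteq> s \<longrightarrow> d \<le> dist s x"
      using finite_set_avoid[OF fin, of s] by blast
    then show ?thesis by (intro exI[of _ d]) (auto simp: dist_real_def abs_minus_commute)
  qed
  have "\<exists>w d. d > 0 \<and> (\<forall>t\<in>?I. t \<noteq> s \<and> \<bar>t - s\<bar> < d \<longrightarrow> q t \<noteq> 0 \<and> f t = w)"
    if s: "s \<in> ?I" "q s = 0" for s
  proof -
    obtain d1 where d1: "d1 > 0" "\<And>t. t \<in> ?I \<Longrightarrow> t \<noteq> s \<Longrightarrow> \<bar>t - s\<bar> < d1 \<Longrightarrow> q t \<noteq> 0"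
      using isol[of s] by blast
    obtain u d2 where d2: "d2 > 0" "\<And>t. t \<in> ?I \<Longrightarrow> \<bar>t - s\<bar> < d2 \<Longrightarrow> \<exists>r\<ge>0. q t = r *\<^sub>R u"
      using ray[OF s] by blast
    have "f t = - sgn u" if t: "t \<in> ?I" "t \<noteq> s" "\<bar>t - s\<bar> < min d1 d2" for t
    proof -
      have qt: "q t \<noteq> 0" using d1 t by simp
      obtain r where r: "r \<ge> 0" "q t = r *\<^sub>R u" using d2(2)[of t] t by auto
      have u: "u \<noteq> 0" "r > 0" using r qt by (auto simp: less_le)
      define h where "h = sgn u"
      have hh: "h \<bullet> h = 1" using u by (simp add: h_def sgn_div_norm power2_norm_eq_inner[symmetric] power2_eq_square)
      have qh: "q t = norm (q t) *\<^sub>R h" using r u by (simp add: h_def sgn_div_norm)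
      \<comment> \<open>The part of the velocity transverse to the ray. It is orthogonal to
        \<open>q\<close> at all times near \<open>t\<close>, hence to \<open>v t\<close>, and so to
        itself.\<close>
      define w where "w = v t - (v t \<bullet> h) *\<^sub>R h"
      have wh: "w \<bullet> h = 0" by (simp add: w_def inner_diff_left hh)
      then have wu: "w \<bullet> u = 0" using u by (simp add: h_def sgn_div_norm)
      have "((\<lambda>t. w \<bullet> q t) has_vector_derivative w \<bullet> v t) (at t within ?I)"
        using bounded_linear.has_vector_derivative[OF bounded_linear_inner_right qd[OF t(1) qt]] .
      moreover have "((\<lambda>t. w \<bullet> q t) has_vector_derivative 0) (at t within ?I)"
      proof (rule has_vector_derivative_transform_within[OF has_vector_derivative_const])
        show "0 < d2 - \<bar>t - s\<bar>" using t by simp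
        fix x assume "x \<in> ?I" "dist x t < d2 - \<bar>t - s\<bar>"
        then have "\<exists>r\<ge>0. q x = r *\<^sub>R u" by (intro d2(2)) (auto simp: dist_real_def)
        then show "0 = w \<bullet> q x" using wu by auto
      qed (rule t)
      moreover have "at t within ?I \<noteq> bot" using t01 t(1) by (simp add: trivial_limit_within islimpt_Icc)
      ultimately have "w \<bullet> v t = 0" by (intro vector_derivative_unique_within)
      then have "w \<bullet> w = 0" using wh unfolding w_def by (simp add: inner_diff_right)
      then have vh: "v t = (v t \<bullet> h) *\<^sub>R h" by (simp add: w_def)
      define m n where "m = v t \<bullet> h" and "n = norm (q t)"
      have vh': "v t = m *\<^sub>R h" and qh': "q t = n *\<^sub>R h" using vh qh by (simp_all add: m_def n_def)
      have "n \<noteq> 0" using qt by (simp add: n_def)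
      have "f t = (m * m * n - n * m * m) *\<^sub>R h - h"
        unfolding f_def n_def[symmetric] unfolding qh' vh'  power2_norm_eq_inner
        using \<open>n \<noteq> 0\<close> by (simp add: hh scaleR_diff_left)
      then show ?thesis by (simp add: h_def)
    qed
    then show ?thesis using d1 d2 by (intro exI[of _ "- sgn u"] exI[of _ "min d1 d2"]) auto
  qed
  then obtain w where w: "\<And>s. s \<in> ?I \<Longrightarrow> q s = 0 \<Longrightarrow>
      \<exists>d>0. \<forall>t\<in>?I. t \<noteq> s \<and> \<bar>t - s\<bar> < d \<longrightarrow> q t \<noteq> 0 \<and> f t = w s" by metis
  \<comment> \<open>At a collision \<open>f\<close> is 0 instead of its limit; \<open>g\<close>
    inserts the limit and becomes constant near every collision.\<close>
  define g where "g = (\<lambda>t. if q t = 0 then w t else f t)"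
  have "(g has_vector_derivative 0) (at s within ?I)" if s: "s \<in> ?I" for s
  proof (cases "q s = 0")
    case True
    then obtain d where d: "d > 0" "\<And>t. t \<in> ?I \<Longrightarrow> t \<noteq> s \<Longrightarrow> \<bar>t - s\<bar> < d \<Longrightarrow> q t \<noteq> 0 \<and> f t = w s"
      using w[OF s] by blast
    show ?thesis
    proof (rule has_vector_derivative_transform_within[OF has_vector_derivative_const d(1) s])
      show "w s = g x" if "x \<in> ?I" "dist x s < d" for x
        using d(2)[of x] that True by (cases "x = s") (auto simp: g_def dist_real_def)
    qed
  next
    case False
    obtain d where d: "d > 0" "\<And>t. t \<in> ?I \<Longrightarrow> t \<noteq> s \<Longrightarrow> \<bar>t - s\<bar> < d \<Longrightarrow> q t \<noteq> 0"
      using isol[of s] by blast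
    have "(f has_vector_derivative 0) (at s within ?I)"
      unfolding f_def using laplace_deriv_zero[OF qd[OF s False] False vd[OF s False]] .
    then show ?thesis
    proof (rule has_vector_derivative_transform_within[OF _ d(1) s])
      show "f x = g x" if "x \<in> ?I" "dist x s < d" for x
        using d(2)[of x] that False by (cases "x = s") (auto simp: g_def dist_real_def)
    qed
  qed
  then obtain e where "\<And>s. s \<in> ?I \<Longrightarrow> g s = e"
    using has_vector_derivative_zero_constant[of ?I g] by auto
  then have "f s = e" if "s \<in> ?I" "q s \<noteq> 0" for s using that by (metis g_def)
  then have "kepler_motion q v t0 t1 E e"
    using t01 cq fin start qd vd en unfolding f_def by unfold_locales auto
  then show ?thesis using that by blast
qed


section \<open>The regularized motion as a linear system\<close>

context kepler_motion
begin

abbreviation "I \<equiv> {t0..t1}"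
abbreviation "K \<equiv> {t \<in> {t0..t1}. q t = 0}"

definition k :: real where "k = E / 2"
definition r :: "real \<Rightarrow> real" where "r t = norm (q t)"
definition sigma :: "real \<Rightarrow> real" where "sigma t = q t \<bullet> v t"
definition y :: "real \<Rightarrow> 'a" where "y t = r t *\<^sub>R v t"
text \<open>The oscillator conserves \<open>z'\<^sup>2 - k z\<^sup>2\<close> and
  \<open>|z'|\<^sup>2 - k |z|\<^sup>2\<close>; their values here are \<open>- e / 2\<close> and 1/2.
  Reading \<open>zeta\<close> and \<open>rho\<close> off these constants instead of the velocity
  makes them continuous at collisions.\<close>

definition zeta :: "real \<Rightarrow> 'a" where "zeta t = k *\<^sub>R q t - (1 / 2) *\<^sub>R e"
definition rho :: "real \<Rightarrow> real" where "rho t = k * r t + 1 / 2"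
text \<open>This is the regularizing time with \<open>ds/dt = 1 / r\<close>: indeed \<open>d sigma/dt = |v|\<^sup>2 - 1 / r = 2 E + 1 / r\<close>.
  In contrast to the integral of \<open>1 / r\<close> it is visibly continuous at collisions, where \<open>sigma = 0\<close>.\<close>

definition s :: "real \<Rightarrow> real" where "s t = sigma t - sigma t0 - 2 * E * (t - t0)"

lemma t0_in: "t0 \<in> I" and t1_in: "t1 \<in> I" using t01 by auto

lemma r_pos: "q t \<noteq> 0 \<Longrightarrow> r t > 0" by (simp add: r_def)

lemma v_sq:
  assumes "t \<in> I" "q t \<noteq> 0" shows "(norm (v t))\<^sup>2 = 4 * k + 2 / r t"
  using energy[OF assms] by (simp add: k_def r_def)

lemma norm_y: "t \<in> I \<Longrightarrow> (norm (y t))\<^sup>2 = 4 * k * (r t)\<^sup>2 + 2 * r t"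
proof (cases "q t = 0")
  case False
  assume "t \<in> I"
  then have "(norm (y t))\<^sup>2 = (r t)\<^sup>2 * (4 * k + 2 / r t)"
    using v_sq[of t] False by (simp add: y_def power_mult_distrib)
  then show ?thesis using r_pos[OF False] by (simp add: distrib_left power2_eq_square)
qed (simp add: y_def r_def)

lemma cont_r: "continuous_on I r"
  unfolding r_def[abs_def] by (intro continuous_intros cont_q)

lemma r_deriv: "t \<in> I \<Longrightarrow> q t \<noteq> 0 \<Longrightarrow> (r has_real_derivative (1 / r t) * sigma t) (at t within I)"
  using norm_has_real_derivative[OF q_deriv, of t] by (simp add: r_def[abs_def] sigma_def)

lemma sigma_deriv:
  assumes "t \<in> I" "q t \<noteq> 0"
  shows "(sigma has_real_derivative (1 / r t) * (2 * k * r t + 2 * rho t)) (at t within I)"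
proof -
  have "(sigma has_real_derivative q t \<bullet> ((- (1 / norm (q t) ^ 3)) *\<^sub>R q t) + v t \<bullet> v t) (at t within I)"
    using bounded_bilinear.has_vector_derivative[OF bounded_bilinear_inner q_deriv[OF assms] v_deriv[OF assms]]
    by (simp add: has_real_derivative_iff_has_vector_derivative sigma_def[abs_def])
  moreover have "q t \<bullet> ((- (1 / norm (q t) ^ 3)) *\<^sub>R q t) + v t \<bullet> v t = - 1 / r t + (4 * k + 2 / r t)"
    unfolding power2_norm_eq_inner[symmetric] v_sq[OF assms, symmetric] using r_pos[OF assms(2)]
    by (simp add: r_def power2_norm_eq_inner[symmetric] power2_eq_square power3_eq_cube)
  moreover have "- 1 / r t + (4 * k + 2 / r t) = (1 / r t) * (2 * k * r t + 2 * rho t)"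
    using r_pos[OF assms(2)] by (simp add: rho_def field_simps)
  ultimately show ?thesis by simp
qed

lemma y_deriv:
  assumes "t \<in> I" "q t \<noteq> 0"
  shows "(y has_vector_derivative (1 / r t) *\<^sub>R ((2 * k) *\<^sub>R q t + 2 *\<^sub>R zeta t)) (at t within I)"
proof -
  have rp: "r t \<noteq> 0" using r_pos[OF assms(2)] by simp
  have "(y has_vector_derivative r t *\<^sub>R ((- (1 / norm (q t) ^ 3)) *\<^sub>R q t) + ((1 / r t) * sigma t) *\<^sub>R v t) (at t within I)"
    unfolding y_def[abs_def] by (intro has_vector_derivative_scaleR r_deriv v_deriv assms)
  moreover have "r t *\<^sub>R ((- (1 / norm (q t) ^ 3)) *\<^sub>R q t) + ((1 / r t) * sigma t) *\<^sub>R v t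
     = (1 / r t) *\<^sub>R (sigma t *\<^sub>R v t - (1 / r t) *\<^sub>R q t)"
    using rp by (simp add: r_def[symmetric] scaleR_diff_right power3_eq_cube)
  moreover have "(2 * k) *\<^sub>R q t + 2 *\<^sub>R zeta t = (4 * k) *\<^sub>R q t - e"
    by (simp add: zeta_def scaleR_diff_right flip: scaleR_add_left)
  moreover have "(4 * k) *\<^sub>R q t - e = sigma t *\<^sub>R v t - (1 / r t) *\<^sub>R q t"
    unfolding laplace[OF assms, symmetric] v_sq[OF assms] r_def[symmetric] sigma_def[symmetric]
    by (simp add: algebra_simps flip: scaleR_add_left)
  ultimately show ?thesis by simp
qed

lemma zeta_deriv:
  assumes "t \<in> I" "q t \<noteq> 0"
  shows "(zeta has_vector_derivative (1 / r t) *\<^sub>R (k *\<^sub>R y t)) (at t within I)"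
proof -
  have "(zeta has_vector_derivative k *\<^sub>R v t - 0) (at t within I)"
    unfolding zeta_def[abs_def]
    by (intro has_vector_derivative_diff has_vector_derivative_const
        bounded_linear.has_vector_derivative[OF bounded_linear_scaleR_right] q_deriv assms)
  then show ?thesis using r_pos[OF assms(2)] by (simp add: y_def)
qed

lemma rho_deriv:
  assumes "t \<in> I" "q t \<noteq> 0"
  shows "(rho has_real_derivative (1 / r t) * (k * sigma t)) (at t within I)"
  unfolding rho_def[abs_def] by (rule derivative_eq_intros r_deriv[OF assms] refl | simp)+

lemma q_deriv':
  assumes "t \<in> I" "q t \<noteq> 0" shows "(q has_vector_derivative (1 / r t) *\<^sub>R y t) (at t within I)"
  using q_deriv[OF assms] r_pos[OF assms(2)] by (simp add: y_def)

text \<open>The speed is unbounded near a collision, but by the energy \<open>norm (y t)\<close> is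
  a continuous function of \<open>r t\<close> that vanishes with it.\<close>

lemma cont_y: "continuous_on I y"
  unfolding continuous_on_def
proof
  fix t assume t: "t \<in> I"
  show "(y \<longlongrightarrow> y t) (at t within I)"
  proof (cases "q t = 0")
    case True
    have "continuous_on I (\<lambda>t. sqrt (4 * k * (r t)\<^sup>2 + 2 * r t))"
      by (intro continuous_intros cont_r)
    then have "continuous_on I (\<lambda>t. norm (y t))"
    proof (rule continuous_on_eq)
      show "sqrt (4 * k * (r t)\<^sup>2 + 2 * r t) = norm (y t)" if "t \<in> I" for t
        using norm_y[OF that] by (metis abs_norm_cancel real_sqrt_abs)
    qed
    then have "((\<lambda>t. norm (y t)) \<longlongrightarrow> norm (y t)) (at t within I)"
      using t by (simp add: continuous_on_def)
    moreover have yt: "y t = 0" using True by (simp add: y_def r_def)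
    ultimately show ?thesis by (simp add: tendsto_norm_zero_cancel)
  next
    case False
    then show ?thesis
      using has_vector_derivative_continuous[OF y_deriv[OF t False]] by (simp add: continuous_within)
  qed
qed

lemma abs_sigma_le: "\<bar>sigma t\<bar> \<le> norm (y t)"
  using Cauchy_Schwarz_ineq2[of "q t" "v t"] by (simp add: sigma_def y_def r_def)

lemma cont_sigma: "continuous_on I sigma"
  unfolding continuous_on_def
proof
  fix t assume t: "t \<in> I"
  show "(sigma \<longlongrightarrow> sigma t) (at t within I)"
  proof (cases "q t = 0")
    case True
    then have y0: "y t = 0" "sigma t = 0" by (simp_all add: y_def r_def sigma_def)
    have "((\<lambda>t. norm (y t)) \<longlongrightarrow> 0) (at t within I)"
      using cont_y t y0 unfolding continuous_on_def by (metis tendsto_norm_zero)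
    then show ?thesis unfolding y0
      by (rule Lim_null_comparison[rotated]) (simp add: abs_sigma_le)
  next
    case False
    then show ?thesis
      using DERIV_continuous[OF sigma_deriv[OF t False]] by (simp add: continuous_within)
  qed
qed

lemma cont_s: "continuous_on I s"
  unfolding s_def[abs_def] by (intro continuous_intros cont_sigma)

lemma s_deriv:
  assumes "t \<in> I" "q t \<noteq> 0" shows "(s has_real_derivative 1 / r t) (at t within I)"
proof -
  have "(1 / r t) * (2 * k * r t + 2 * rho t) - 2 * E = 1 / r t"
    using r_pos[OF assms(2)] by (simp add: rho_def k_def field_simps)
  moreover have "(s has_real_derivative (1 / r t) * (2 * k * r t + 2 * rho t) - 0 - 2 * E * (1 - 0)) (at t within I)"
    unfolding s_def[abs_def]
    by (intro DERIV_diff DERIV_cmult sigma_deriv assms DERIV_const DERIV_ident)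
  ultimately show ?thesis by simp
qed

lemma s_start [simp]: "s t0 = 0" by (simp add: s_def)

lemma s_strict_mono:
  assumes "t0 \<le> x" "x < z" "z \<le> t1" shows "s x < s z"
proof (rule strict_increasing_except_finite[OF finite_collisions assms(2)])
  show "continuous_on {x..z} s" using continuous_on_subset[OF cont_s] assms by auto
  show "(s has_real_derivative 1 / r t) (at t within {x..z})" "1 / r t > 0"
    if "t \<in> {x..z} - K" for t
    using that assms DERIV_subset[OF s_deriv[of t], of "{x..z}"] r_pos[of t] by auto
qed

text \<open>The triples \<open>(q, y, zeta)\<close> and \<open>(r, sigma, rho)\<close> stand for \<open>(z\<^sup>2, 2 z z', z'\<^sup>2)\<close> and
  \<open>(|z|\<^sup>2, 2 Re (z cnj z'), |z'|\<^sup>2)\<close>, so both evolve by the symmetric square of the oscillator.\<close>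

lemma evolution:
  fixes f g h :: "real \<Rightarrow> 'b::euclidean_space"
  assumes cont: "continuous_on I f" "continuous_on I g" "continuous_on I h"
    and f': "\<And>t. t \<in> I \<Longrightarrow> q t \<noteq> 0 \<Longrightarrow> (f has_vector_derivative (1 / r t) *\<^sub>R g t) (at t within I)"
    and g': "\<And>t. t \<in> I \<Longrightarrow> q t \<noteq> 0 \<Longrightarrow>
         (g has_vector_derivative (1 / r t) *\<^sub>R ((2 * k) *\<^sub>R f t + 2 *\<^sub>R h t)) (at t within I)"
    and h': "\<And>t. t \<in> I \<Longrightarrow> q t \<noteq> 0 \<Longrightarrow> (h has_vector_derivative (1 / r t) *\<^sub>R (k *\<^sub>R g t)) (at t within I)"
    and t: "t \<in> I"
  defines "c \<equiv> kcos k (s t)" and "n \<equiv> ksin k (s t)"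
  shows "f t = c\<^sup>2 *\<^sub>R f t0 + (c * n) *\<^sub>R g t0 + n\<^sup>2 *\<^sub>R h t0"
    and "g t = (2 * k * c * n) *\<^sub>R f t0 + (c\<^sup>2 + k * n\<^sup>2) *\<^sub>R g t0 + (2 * c * n) *\<^sub>R h t0"
proof -
  have cc: "continuous_on I (\<lambda>t. kcos k (s t))" "continuous_on I (\<lambda>t. ksin k (s t))"
    by (rule continuous_on_compose2[OF DERIV_continuous_on[OF kcos_has_derivative] cont_s] subset_UNIV
          continuous_on_compose2[OF DERIV_continuous_on[OF ksin_has_derivative] cont_s])+
  define u z where "u = (\<lambda>t. kcos k (s t))" and "z = (\<lambda>t. ksin k (s t))"
  have uz: "continuous_on I u" "continuous_on I z" using cc by (simp_all add: u_def z_def)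
  have u': "(u has_real_derivative (1 / r x) * (k * z x)) (at x within I)"
    and z': "(z has_real_derivative (1 / r x) * u x) (at x within I)" if "x \<in> I" "q x \<noteq> 0" for x
    using DERIV_chain2[OF kcos_has_derivative s_deriv[OF that]] DERIV_chain2[OF ksin_has_derivative s_deriv[OF that]]
    by (simp_all add: u_def z_def mult.commute)
  have uu': "((\<lambda>t. (u t)\<^sup>2) has_real_derivative (1 / r x) * (2 * k * (u x * z x))) (at x within I)"
    and uz': "((\<lambda>t. u t * z t) has_real_derivative (1 / r x) * ((u x)\<^sup>2 + k * (z x)\<^sup>2)) (at x within I)"
    and zz': "((\<lambda>t. (z t)\<^sup>2) has_real_derivative (1 / r x) * (2 * (u x * z x))) (at x within I)"
    if "x \<in> I" "q x \<noteq> 0" for x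
    using DERIV_mult[OF u'[OF that] u'[OF that]] DERIV_mult[OF u'[OF that] z'[OF that]]
      DERIV_mult[OF z'[OF that] z'[OF that]]
    by (simp_all add: power2_eq_square algebra_simps)
  \<comment> \<open>Coefficients obeying the adjoint equations make the combination constant;
    collisions are bridged by continuity. Facts 1 to 3 apply this to the inverse evolution, and
    \<open>c\<^sup>2 - k * n\<^sup>2 = 1\<close> turns them into the forward formulas.\<close>
  have conserved: "F1 t *\<^sub>R f t + F2 t *\<^sub>R g t + F3 t *\<^sub>R h t = F1 t0 *\<^sub>R f t0 + F2 t0 *\<^sub>R g t0 + F3 t0 *\<^sub>R h t0"
    if F1: "\<And>x. x \<in> I \<Longrightarrow> q x \<noteq> 0 \<Longrightarrow> (F1 has_real_derivative (1 / r x) * (- 2 * k * F2 x)) (at x within I)"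
      and F2: "\<And>x. x \<in> I \<Longrightarrow> q x \<noteq> 0 \<Longrightarrow> (F2 has_real_derivative (1 / r x) * (- F1 x - k * F3 x)) (at x within I)"
      and F3: "\<And>x. x \<in> I \<Longrightarrow> q x \<noteq> 0 \<Longrightarrow> (F3 has_real_derivative (1 / r x) * (- 2 * F2 x)) (at x within I)"
      and Fc: "continuous_on I F1" "continuous_on I F2" "continuous_on I F3"
    for F1 F2 F3 :: "real \<Rightarrow> real"
  proof (rule has_derivative_zero_unique_strong_interval[OF finite_collisions _ _ _ t])
    show "continuous_on I (\<lambda>t. F1 t *\<^sub>R f t + F2 t *\<^sub>R g t + F3 t *\<^sub>R h t)"
      by (intro continuous_intros Fc cont)
    fix x assume "x \<in> I - K"
    then have x: "x \<in> I" "q x \<noteq> 0" by auto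
    have "((\<lambda>t. F1 t *\<^sub>R f t + F2 t *\<^sub>R g t + F3 t *\<^sub>R h t) has_vector_derivative
        (F1 x *\<^sub>R ((1 / r x) *\<^sub>R g x) + ((1 / r x) * (- 2 * k * F2 x)) *\<^sub>R f x)
      + (F2 x *\<^sub>R ((1 / r x) *\<^sub>R ((2 * k) *\<^sub>R f x + 2 *\<^sub>R h x)) + ((1 / r x) * (- F1 x - k * F3 x)) *\<^sub>R g x)
      + (F3 x *\<^sub>R ((1 / r x) *\<^sub>R (k *\<^sub>R g x)) + ((1 / r x) * (- 2 * F2 x)) *\<^sub>R h x)) (at x within I)"
      by (intro has_vector_derivative_add has_vector_derivative_scaleR F1 F2 F3 f' g' h' x)
    moreover have "(F1 x *\<^sub>R (i *\<^sub>R g x) + (i * (- 2 * k * F2 x)) *\<^sub>R f x)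
      + (F2 x *\<^sub>R (i *\<^sub>R ((2 * k) *\<^sub>R f x + 2 *\<^sub>R h x)) + (i * (- F1 x - k * F3 x)) *\<^sub>R g x)
      + (F3 x *\<^sub>R (i *\<^sub>R (k *\<^sub>R g x)) + (i * (- 2 * F2 x)) *\<^sub>R h x) = 0" for i
      by (simp add: algebra_simps)
    ultimately have "((\<lambda>t. F1 t *\<^sub>R f t + F2 t *\<^sub>R g t + F3 t *\<^sub>R h t) has_vector_derivative 0) (at x within I)"
      by (simp only:)
    then show "((\<lambda>t. F1 t *\<^sub>R f t + F2 t *\<^sub>R g t + F3 t *\<^sub>R h t) has_derivative (\<lambda>h. 0)) (at x within I)"
      by (simp add: has_vector_derivative_def)
  qed simp
  have start: "u t0 = 1" "z t0 = 0" by (simp_all add: u_def z_def)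
  have 1: "(u t)\<^sup>2 *\<^sub>R f t + (- (u t * z t)) *\<^sub>R g t + (z t)\<^sup>2 *\<^sub>R h t = f t0"
  proof -
    have "(u t)\<^sup>2 *\<^sub>R f t + (- (u t * z t)) *\<^sub>R g t + (z t)\<^sup>2 *\<^sub>R h t
        = (u t0)\<^sup>2 *\<^sub>R f t0 + (- (u t0 * z t0)) *\<^sub>R g t0 + (z t0)\<^sup>2 *\<^sub>R h t0"
      by (rule conserved[of "\<lambda>t. (u t)\<^sup>2" "\<lambda>t. - (u t * z t)" "\<lambda>t. (z t)\<^sup>2"])
         ((rule DERIV_cong[OF uu'] DERIV_cong[OF DERIV_minus[OF uz']] DERIV_cong[OF zz'],
           assumption, assumption, simp add: algebra_simps)+, (intro continuous_intros uz)+)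
    then show ?thesis by (simp add: start)
  qed
  have 2: "(- (2 * k * (u t * z t))) *\<^sub>R f t + ((u t)\<^sup>2 + k * (z t)\<^sup>2) *\<^sub>R g t + (- (2 * (u t * z t))) *\<^sub>R h t = g t0"
  proof -
    have "(- (2 * k * (u t * z t))) *\<^sub>R f t + ((u t)\<^sup>2 + k * (z t)\<^sup>2) *\<^sub>R g t + (- (2 * (u t * z t))) *\<^sub>R h t
       = (- (2 * k * (u t0 * z t0))) *\<^sub>R f t0 + ((u t0)\<^sup>2 + k * (z t0)\<^sup>2) *\<^sub>R g t0 + (- (2 * (u t0 * z t0))) *\<^sub>R h t0"
      by (rule conserved[of "\<lambda>t. - (2 * k * (u t * z t))" "\<lambda>t. (u t)\<^sup>2 + k * (z t)\<^sup>2" "\<lambda>t. - (2 * (u t * z t))"])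
         ((rule DERIV_cong[OF DERIV_minus[OF DERIV_cmult[OF uz']]] DERIV_cong[OF DERIV_add[OF uu' DERIV_cmult[OF zz']]],
           assumption+, simp add: algebra_simps)+, (intro continuous_intros uz)+)
    then show ?thesis by (simp add: start)
  qed
  have 3: "(k\<^sup>2 * (z t)\<^sup>2) *\<^sub>R f t + (- (k * (u t * z t))) *\<^sub>R g t + (u t)\<^sup>2 *\<^sub>R h t = h t0"
  proof -
    have "(k\<^sup>2 * (z t)\<^sup>2) *\<^sub>R f t + (- (k * (u t * z t))) *\<^sub>R g t + (u t)\<^sup>2 *\<^sub>R h t
       = (k\<^sup>2 * (z t0)\<^sup>2) *\<^sub>R f t0 + (- (k * (u t0 * z t0))) *\<^sub>R g t0 + (u t0)\<^sup>2 *\<^sub>R h t0"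
      by (rule conserved[of "\<lambda>t. k\<^sup>2 * (z t)\<^sup>2" "\<lambda>t. - (k * (u t * z t))" "\<lambda>t. (u t)\<^sup>2"])
         ((rule DERIV_cong[OF DERIV_cmult[OF zz']] DERIV_cong[OF DERIV_minus[OF DERIV_cmult[OF uz']]] DERIV_cong[OF uu'],
           assumption, assumption, simp add: algebra_simps power2_eq_square[of k])+, (intro continuous_intros uz)+)
    then show ?thesis by (simp add: start)
  qed
  have cn': "c = u t" "n = z t" by (simp_all add: c_def n_def u_def z_def)
  have cn: "c\<^sup>2 - k * n\<^sup>2 = 1" unfolding c_def n_def by (rule kcos_ksin_pythagoras)
  show "f t = c\<^sup>2 *\<^sub>R f t0 + (c * n) *\<^sub>R g t0 + n\<^sup>2 *\<^sub>R h t0"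
    unfolding 1[symmetric] 2[symmetric] 3[symmetric]
    by (rule euclidean_eqI) (simp add: inner_simps, use cn[unfolded cn'] in \<open>simp add: cn'; algebra\<close>)
  show "g t = (2 * k * c * n) *\<^sub>R f t0 + (c\<^sup>2 + k * n\<^sup>2) *\<^sub>R g t0 + (2 * c * n) *\<^sub>R h t0"
    unfolding 1[symmetric] 2[symmetric] 3[symmetric]
    by (rule euclidean_eqI) (simp add: inner_simps, use cn[unfolded cn'] in \<open>simp add: cn'; algebra\<close>)
qed

end

context kepler_motion
begin

lemma q_evolution:
  assumes "t \<in> I"
  shows "q t = (kcos k (s t))\<^sup>2 *\<^sub>R q t0 + (kcos k (s t) * ksin k (s t)) *\<^sub>R y t0 + (ksin k (s t))\<^sup>2 *\<^sub>R zeta t0"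
  by (rule evolution(1)[OF cont_q cont_y _ q_deriv' y_deriv zeta_deriv assms])
     (auto simp: zeta_def[abs_def] intro!: continuous_intros cont_q)

lemma r_sigma_evolution:
  assumes "t \<in> I"
  shows "r t = (kcos k (s t))\<^sup>2 * r t0 + kcos k (s t) * ksin k (s t) * sigma t0 + (ksin k (s t))\<^sup>2 * rho t0" (is ?r)
    and "sigma t = 2 * k * kcos k (s t) * ksin k (s t) * r t0 + ((kcos k (s t))\<^sup>2 + k * (ksin k (s t))\<^sup>2) * sigma t0
           + 2 * kcos k (s t) * ksin k (s t) * rho t0" (is ?s)
proof -
  have c: "continuous_on I rho" unfolding rho_def[abs_def] by (intro continuous_intros cont_r)
  have d: "(r has_vector_derivative (1 / r t) *\<^sub>R sigma t) (at t within I)"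
    "(sigma has_vector_derivative (1 / r t) *\<^sub>R ((2 * k) *\<^sub>R r t + 2 *\<^sub>R rho t)) (at t within I)"
    "(rho has_vector_derivative (1 / r t) *\<^sub>R (k *\<^sub>R sigma t)) (at t within I)"
    if "t \<in> I" "q t \<noteq> 0" for t
    using r_deriv[OF that] sigma_deriv[OF that] rho_deriv[OF that]
    by (simp_all add: has_real_derivative_iff_has_vector_derivative)
  show ?r ?s
    using evolution[OF cont_r cont_sigma c d assms] by simp_all
qed

text \<open>In complex form \<open>2 |z|\<^sup>2 z'\<^sup>2 = 2 Re (z cnj z') * 2 z z' - 2
  |z'|\<^sup>2 z\<^sup>2\<close>. It expresses \<open>zeta t0\<close> by \<open>q t0\<close> and
  \<open>y t0\<close>, which keeps the motion in their plane.\<close>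

lemma zeta_start: "(2 * r t0) *\<^sub>R zeta t0 = sigma t0 *\<^sub>R y t0 - (2 * rho t0) *\<^sub>R q t0"
proof -
  have rp: "r t0 \<noteq> 0" using r_pos[OF start] by simp
  have "r t0 *\<^sub>R e = (4 * k * r t0 + 1) *\<^sub>R q t0 - sigma t0 *\<^sub>R y t0"
  proof -
    have "r t0 *\<^sub>R e = r t0 *\<^sub>R ((4 * k + 2 / r t0) *\<^sub>R q t0 - sigma t0 *\<^sub>R v t0 - (1 / r t0) *\<^sub>R q t0)"
      unfolding laplace[OF t0_in start, symmetric] v_sq[OF t0_in start] r_def[symmetric] sigma_def[symmetric] ..
    also have "\<dots> = (r t0 * (4 * k + 2 / r t0) - r t0 * (1 / r t0)) *\<^sub>R q t0 - sigma t0 *\<^sub>R y t0"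
      by (simp add: y_def algebra_simps)
    also have "r t0 * (4 * k + 2 / r t0) - r t0 * (1 / r t0) = 4 * k * r t0 + 1"
      using rp by (simp add: field_simps)
    finally show ?thesis .
  qed
  then have "(2 * r t0) *\<^sub>R zeta t0 = (2 * r t0 * k) *\<^sub>R q t0 - ((4 * k * r t0 + 1) *\<^sub>R q t0 - sigma t0 *\<^sub>R y t0)"
    by (simp add: zeta_def scaleR_diff_right)
  also have "a *\<^sub>R q t0 - (b *\<^sub>R q t0 - x) = (a - b) *\<^sub>R q t0 + x" for a b x
    by (simp add: scaleR_diff_left)
  also have "2 * r t0 * k - (4 * k * r t0 + 1) = - (2 * rho t0)" by (simp add: rho_def)
  finally show ?thesis by simp
qed

lemma inner_start: "q t0 \<bullet> q t0 = (r t0)\<^sup>2" "q t0 \<bullet> y t0 = r t0 * sigma t0"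
  "q t0 \<bullet> zeta t0 = (sigma t0)\<^sup>2 / 2 - rho t0 * r t0"
proof -
  show 1: "q t0 \<bullet> q t0 = (r t0)\<^sup>2" by (simp add: r_def power2_norm_eq_inner)
  show 2: "q t0 \<bullet> y t0 = r t0 * sigma t0" by (simp add: y_def sigma_def)
  have "2 * r t0 * (q t0 \<bullet> zeta t0) = sigma t0 * (r t0 * sigma t0) - 2 * rho t0 * (r t0)\<^sup>2"
    using arg_cong[OF zeta_start, of "\<lambda>v. q t0 \<bullet> v"] by (simp add: inner_simps 1 2)
  then have "2 * r t0 * (q t0 \<bullet> zeta t0) = 2 * r t0 * ((sigma t0)\<^sup>2 / 2 - rho t0 * r t0)"
    by (simp add: power2_eq_square algebra_simps)
  then show "q t0 \<bullet> zeta t0 = (sigma t0)\<^sup>2 / 2 - rho t0 * r t0"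
    using r_pos[OF start] by simp
qed

text \<open>\<open>P t\<close> is the inner product of \<open>z t0\<close> and \<open>z t\<close>.\<close>

definition P :: "real \<Rightarrow> real" where
  "P t = r t0 * kcos k (s t) + sigma t0 / 2 * ksin k (s t)"

lemma P_start: "P t0 = r t0" by (simp add: P_def)

lemma P_sq:
  assumes "t \<in> I" shows "2 * (P t)\<^sup>2 = r t0 * r t + q t0 \<bullet> q t"
proof -
  have "q t0 \<bullet> q t = (kcos k (s t))\<^sup>2 * (r t0)\<^sup>2 + kcos k (s t) * ksin k (s t) * (r t0 * sigma t0)
      + (ksin k (s t))\<^sup>2 * ((sigma t0)\<^sup>2 / 2 - rho t0 * r t0)"
    unfolding q_evolution[OF assms] by (simp add: inner_simps inner_start)
  then show ?thesis
    unfolding P_def r_sigma_evolution(1)[OF assms] by (simp add: power2_eq_square algebra_simps)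
qed

lemma cont_P: "continuous_on I P"
  unfolding P_def[abs_def]
  by (intro continuous_intros
      continuous_on_compose2[OF DERIV_continuous_on[OF kcos_has_derivative] cont_s subset_UNIV]
      continuous_on_compose2[OF DERIV_continuous_on[OF ksin_has_derivative] cont_s subset_UNIV])

text \<open>\<open>P\<close> starts at \<open>r t0 > 0\<close>, so it has a zero, and by
  \<open>P_sq\<close> the position there is opposite to \<open>q t0\<close> or is the centre
  itself.\<close>

lemma indirect_if_P_nonpos:
  assumes "t \<in> I" "P t \<le> 0" shows "0 \<in> convex hull (q ` I)"
proof -
  have "\<exists>x\<ge>t0. x \<le> t \<and> P x = 0"
    by (rule IVT2') (use assms r_pos[OF start] P_start in \<open>auto intro: continuous_on_subset[OF cont_P]\<close>)
  then obtain x where "t0 \<le> x" "x \<le> t" "P x = 0" by blast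
  then have x: "x \<in> I" "P x = 0" using assms by auto
  then have "norm (q t0) * norm (q x) + q t0 \<bullet> q x = 0" using P_sq[OF x(1)] by (simp add: r_def)
  then have "0 \<in> closed_segment (q t0) (q x)" using start by (intro zero_in_segment_if_opposite)
  also have "closed_segment (q t0) (q x) \<subseteq> convex hull (q ` I)"
    unfolding segment_convex_hull by (rule hull_mono) (use x t0_in in auto)
  finally show ?thesis .
qed

lemma s_range:
  assumes "t \<in> I" shows "0 \<le> s t" "s t \<le> s t1"
  using s_strict_mono[of t0 t] s_strict_mono[of t t1] assms
  by (cases "t = t0"; cases "t = t1"; simp)+

lemma s_onto:
  assumes "0 \<le> x" "x \<le> s t1" obtains t where "t \<in> I" "s t = x"
proof -
  have "\<exists>t\<ge>t0. t \<le> t1 \<and> s t = x"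
    by (rule IVT') (use assms t01 in \<open>auto intro: cont_s\<close>)
  then show ?thesis using that by auto
qed

section \<open>Arcs of at least one turn\<close>

context
  assumes k_neg: "k < 0" and long: "pi \<le> sqrt (- k) * s t1"
begin

text \<open>This shift is a half turn of \<open>z\<close>, which only changes its sign, and thus a
  full turn of \<open>q\<close>.\<close>

lemma kcos_shift: "kcos k (x + pi / sqrt (- k)) = - kcos k x"
  and ksin_shift: "ksin k (x + pi / sqrt (- k)) = - ksin k x"
proof -
  have "sqrt (- k) * (x + pi / sqrt (- k)) = sqrt (- k) * x + pi"
    using k_neg by (simp add: field_simps)
  then show "kcos k (x + pi / sqrt (- k)) = - kcos k x" "ksin k (x + pi / sqrt (- k)) = - ksin k x"
    using k_neg by (simp_all add: kcos_def ksin_def)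
qed

lemma half_turn: "0 < pi / sqrt (- k)" "pi / sqrt (- k) \<le> s t1"
  using k_neg long by (simp_all add: field_simps)

lemma long_indirect: "0 \<in> convex hull (q ` I)"
proof -
  obtain t where t: "t \<in> I" "s t = pi / sqrt (- k)"
    using s_onto[of "pi / sqrt (- k)"] half_turn by auto
  have "P t = - r t0"
    using kcos_shift[of 0] ksin_shift[of 0] by (simp add: P_def t)
  then show ?thesis using indirect_if_P_nonpos[OF t(1)] r_pos[OF start] by simp
qed

text \<open>Since \<open>s\<close> is the eccentric anomaly up to scale, the definition of \<open>s\<close> is Kepler's equation;
  increasing \<open>s\<close> by a full turn of \<open>q\<close> takes the same time from every starting point.\<close>

lemma shift_time:
  assumes "t \<in> I" "t' \<in> I" "s t' = s t + pi / sqrt (- k)"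
  shows "t' - t = - (pi / sqrt (- k)) / (4 * k)" "q t' = q t"
proof -
  have "sigma t' = sigma t"
    unfolding r_sigma_evolution(2)[OF assms(1)] r_sigma_evolution(2)[OF assms(2)] assms(3)
    by (simp add: kcos_shift ksin_shift)
  then have "s t' - s t = - (4 * k) * (t' - t)" by (simp add: s_def k_def algebra_simps)
  then have "(t' - t) * (4 * k) = - (pi / sqrt (- k))" using assms(3) by simp
  then show "t' - t = - (pi / sqrt (- k)) / (4 * k)"
    by (rule nonzero_eq_divide_eq[THEN iffD2, rotated]) (use k_neg in simp)
  show "q t' = q t"
    unfolding q_evolution[OF assms(1)] q_evolution[OF assms(2)] assms(3)
    by (simp add: kcos_shift ksin_shift)
qed

lemma long_multi_revolution:
  assumes "q t0 \<noteq> q t1" shows "multi_revolution 0 q t0 t1"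
proof -
  define T where "T = - (pi / sqrt (- k)) / (4 * k)"
  have T: "T > 0" unfolding T_def using half_turn(1) k_neg by (intro divide_neg_neg) simp_all
  obtain m where m: "m \<in> I" "s m = s t1 - pi / sqrt (- k)"
    using s_onto[of "s t1 - pi / sqrt (- k)"] half_turn by auto
  then have mT: "t1 - m = T" "q t1 = q m" using shift_time[OF m(1) t1_in] by (simp_all add: T_def)
  \<comment> \<open>\<open>m = t0\<close> would be exactly one period, while
    \<open>multi_revolution\<close> demands a strictly shorter one; distinct endpoints exclude
    it.\<close>
  then have "m \<noteq> t0" using assms by auto
  then have "T < t1 - t0" using m mT by auto
  moreover have "q (t + T) = q t" if t: "t \<in> {t0..t1 - T}" for t
  proof -
    have tI: "t \<in> I" using t T by auto
    have "t \<le> m" using t mT by simp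
    then have "s t \<le> s m" using s_strict_mono[of t m] t m by (cases "t = m") auto
    then obtain t' where t': "t' \<in> I" "s t' = s t + pi / sqrt (- k)"
      using s_onto[of "s t + pi / sqrt (- k)"] s_range[OF tI] m half_turn by auto
    have "t' = t + T" using shift_time(1)[OF tI t'] by (simp add: T_def)
    then show ?thesis using shift_time(2)[OF tI t'] by simp
  qed
  ultimately show ?thesis
    unfolding multi_revolution_def indirect_arc_def using long_indirect T by blast
qed

end

section \<open>Arcs of less than one turn\<close>

context
  assumes short: "k < 0 \<Longrightarrow> sqrt (- k) * s t1 < pi"
    and ends: "q t1 \<noteq> 0" "q t0 \<noteq> q t1" and P_end: "P t1 \<noteq> 0"
begin

abbreviation "A \<equiv> q t0"
abbreviation "B \<equiv> q t1"
abbreviation "S \<equiv> s t1"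

lemma S_pos: "S > 0" using s_strict_mono[of t0 t1] t01 by simp

lemma ksin_pos_short:
  assumes "0 < x" "x \<le> S" shows "ksin k x > 0"
proof (rule ksin_pos[OF assms(1)])
  assume "k < 0"
  then have "sqrt (- k) * x \<le> sqrt (- k) * S" using assms by (intro mult_left_mono) auto
  then show "sqrt (- k) * x < pi" using short[OF \<open>k < 0\<close>] by simp
qed

text \<open>Expand \<open>|\<beta> - c \<alpha>|\<^sup>2 = n\<^sup>2 |\<alpha>'|\<^sup>2\<close>,
  where \<open>\<beta> = c \<alpha> + n \<alpha>'\<close> with \<open>c = kcos k S\<close>,
  \<open>n = ksin k S\<close> and \<open>\<alpha>'\<close> the initial derivative of
  \<open>z\<close>, using \<open>|\<alpha>'|\<^sup>2 = k |\<alpha>|\<^sup>2 + 1/2\<close>. This is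
  the origin of the factor \<open>sqrt (2 * w)\<close> in the time.\<close>

lemma w_eq: "2 * (norm A + norm B - 2 * P t1 * kcos k S) = (ksin k S)\<^sup>2"
  using kcos_ksin_pythagoras[of k S] r_sigma_evolution(1)[OF t1_in]
  unfolding P_def rho_def r_def by algebra

lemma short_family: "lambert_family A B (P t1) (kcos k S)"
proof
  show "kcos k S > -1" by (rule kcos_gt_minus_1[OF S_pos short])
  have "(ksin k S)\<^sup>2 > 0" using ksin_pos_short[OF S_pos] by simp
  then show "0 < norm A + norm B - 2 * P t1 * kcos k S" unfolding w_eq[symmetric] by simp
  show "2 * (P t1)\<^sup>2 = norm A * norm B + A \<bullet> B" using P_sq[OF t1_in] by (simp add: r_def)
qed (use ends P_end start in auto)

text \<open>This is \<open>2 \<alpha> \<beta>\<close> with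
  \<open>\<beta> = c \<alpha> + n \<alpha>'\<close> inserted, since \<open>y t0\<close> stands for
  \<open>2 \<alpha> \<alpha>'\<close>. It identifies the vector built from the endpoints alone with
  the initial data of the motion.\<close>

lemma mid_eq: "2 *\<^sub>R lambert_mid A B (P t1) = (2 * kcos k S) *\<^sub>R A + ksin k S *\<^sub>R y t0"
proof -
  interpret lambert_family A B "P t1" "kcos k S" by (rule short_family)
  have "norm B *\<^sub>R A + norm A *\<^sub>R B = P t1 *\<^sub>R ((2 * kcos k S) *\<^sub>R A + ksin k S *\<^sub>R y t0)"
  proof (rule euclidean_eqI)
    fix b :: 'a assume "b \<in> Basis"
    have 1: "2 * r t0 * (zeta t0 \<bullet> b) = sigma t0 * (y t0 \<bullet> b) - 2 * rho t0 * (A \<bullet> b)"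
      using arg_cong[OF zeta_start, of "\<lambda>v. v \<bullet> b"] by (simp add: inner_simps)
    have 2: "B \<bullet> b = (kcos k S)\<^sup>2 * (A \<bullet> b) + kcos k S * ksin k S * (y t0 \<bullet> b) + (ksin k S)\<^sup>2 * (zeta t0 \<bullet> b)"
      by (subst q_evolution[OF t1_in]) (simp add: inner_simps)
    show "(norm B *\<^sub>R A + norm A *\<^sub>R B) \<bullet> b = (P t1 *\<^sub>R ((2 * kcos k S) *\<^sub>R A + ksin k S *\<^sub>R y t0)) \<bullet> b"
      using 1 2 r_sigma_evolution(1)[OF t1_in] unfolding P_def r_def[symmetric]
      by (simp add: inner_simps) algebra
  qed
  then have "P t1 *\<^sub>R (2 *\<^sub>R lambert_mid A B (P t1)) = P t1 *\<^sub>R ((2 * kcos k S) *\<^sub>R A + ksin k S *\<^sub>R y t0)"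
    using mid_scaled by (simp add: mult.commute)
  from iffD1[OF scaleR_cancel_left this] show ?thesis using P_end by blast
qed

definition xi :: "real \<Rightarrow> real" where
  "xi t = ksin k (s t) / (ksin k (s t) + ksin k (S - s t))"

lemma den_pos:
  assumes "t \<in> I" shows "ksin k (s t) \<ge> 0" "ksin k (S - s t) \<ge> 0" "ksin k (s t) + ksin k (S - s t) > 0"
proof -
  show a: "ksin k (s t) \<ge> 0"
    using ksin_pos_short[of "s t"] s_range[OF assms] by (cases "s t = 0") auto
  show b: "ksin k (S - s t) \<ge> 0"
    using ksin_pos_short[of "S - s t"] s_range[OF assms] by (cases "s t = S") auto
  show "ksin k (s t) + ksin k (S - s t) > 0"
    using a b ksin_pos_short[of "s t"] ksin_pos_short[of S] s_range[OF assms] S_pos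
    by (cases "s t = 0") (auto simp: add_pos_nonneg)
qed

lemma xi_in: "t \<in> I \<Longrightarrow> xi t \<in> {0..1}"
  using den_pos[of t] by (simp add: xi_def)

lemma one_minus_xi: "t \<in> I \<Longrightarrow> 1 - xi t = ksin k (S - s t) / (ksin k (s t) + ksin k (S - s t))"
  using den_pos(3)[of t] by (simp add: xi_def field_simps)

text \<open>For negative \<open>k\<close> this is the identity \<open>sin\<^sup>2 u + sin\<^sup>2 v
  + 2 cos (u + v) sin u sin v = sin\<^sup>2 (u + v)\<close>.\<close>

lemma lambert_den_xi:
  assumes "t \<in> I" shows "lambert_den (kcos k S) (xi t) = (ksin k S)\<^sup>2 / (ksin k (s t) + ksin k (S - s t))\<^sup>2"
proof -
  have "(ksin k (S - s t))\<^sup>2 + (ksin k (s t))\<^sup>2 + 2 * kcos k S * ksin k (s t) * ksin k (S - s t) = (ksin k S)\<^sup>2"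
    using ksin_diff[of k S "s t"] kcos_ksin_pythagoras[of k S] kcos_ksin_pythagoras[of k "s t"] by algebra
  then show ?thesis
    unfolding lambert_den_def one_minus_xi[OF assms] unfolding xi_def
    by (simp add: power_divide power2_eq_square add_divide_distrib[symmetric])
qed

lemma q_xi:
  assumes "t \<in> I" shows "q t = lambert_point A B (P t1) (kcos k S) (xi t)"
proof -
  let ?u = "ksin k (s t)" and ?z = "ksin k (S - s t)"
  define d where "d = ?u + ?z"
  have d: "d \<noteq> 0" using den_pos(3)[OF assms] by (simp add: d_def)
  have n: "ksin k S \<noteq> 0" using ksin_pos_short[OF S_pos] by simp
  have quad: "lambert_quad A B (P t1) (xi t) = (1 / d\<^sup>2) *\<^sub>R (?z\<^sup>2 *\<^sub>R A + ?u\<^sup>2 *\<^sub>R B + (?u * ?z) *\<^sub>R (2 *\<^sub>R lambert_mid A B (P t1)))"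
    unfolding lambert_quad_def one_minus_xi[OF assms] unfolding xi_def d_def[symmetric]
    by (simp add: power_divide scaleR_add_right power2_eq_square mult_ac)
  have "?z\<^sup>2 *\<^sub>R A + ?u\<^sup>2 *\<^sub>R B + (?u * ?z) *\<^sub>R ((2 * kcos k S) *\<^sub>R A + ksin k S *\<^sub>R y t0) = (ksin k S)\<^sup>2 *\<^sub>R q t"
  proof (rule euclidean_eqI)
    fix b :: 'a assume "b \<in> Basis"
    have gen: "(n * cs - c * u)\<^sup>2 * a + u\<^sup>2 * (c\<^sup>2 * a + c * n * y + n\<^sup>2 * z) + u * (n * cs - c * u) * (2 * c * a + n * y)
        = n\<^sup>2 * (cs\<^sup>2 * a + cs * u * y + u\<^sup>2 * z)" for n cs c u a y z :: real
      by algebra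
    have 1: "q t' \<bullet> b = (kcos k (s t'))\<^sup>2 * (A \<bullet> b) + kcos k (s t') * ksin k (s t') * (y t0 \<bullet> b) + (ksin k (s t'))\<^sup>2 * (zeta t0 \<bullet> b)"
      if "t' \<in> I" for t' by (subst q_evolution[OF that]) (simp add: inner_simps)
    show "(?z\<^sup>2 *\<^sub>R A + ?u\<^sup>2 *\<^sub>R B + (?u * ?z) *\<^sub>R ((2 * kcos k S) *\<^sub>R A + ksin k S *\<^sub>R y t0)) \<bullet> b = ((ksin k S)\<^sup>2 *\<^sub>R q t) \<bullet> b"
      using 1[OF assms] 1[OF t1_in] ksin_diff[of k S "s t"] by (simp add: inner_simps) (rule gen)
  qed
  then show ?thesis
    unfolding lambert_point_def quad lambert_den_xi[OF assms] mid_eq d_def[symmetric] using d n by simp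
qed

lemma xi_deriv:
  assumes "t \<in> I" "q t \<noteq> 0"
  shows "(xi has_real_derivative (ksin k S / (ksin k (s t) + ksin k (S - s t))\<^sup>2) * (1 / r t)) (at t within I)"
proof -
  let ?u = "ksin k (s t)" and ?z = "ksin k (S - s t)"
  note sd = s_deriv[OF assms]
  have u': "((\<lambda>t. ksin k (s t)) has_real_derivative kcos k (s t) * (1 / r t)) (at t within I)"
    by (rule DERIV_chain2[OF ksin_has_derivative sd])
  have z': "((\<lambda>t. ksin k (S - s t)) has_real_derivative kcos k (S - s t) * (0 - 1 / r t)) (at t within I)"
    by (rule DERIV_chain2[OF ksin_has_derivative DERIV_diff[OF DERIV_const sd]])
  have n: "kcos k (s t) * ?z + ?u * kcos k (S - s t) = ksin k S"
    using ksin_diff[of k S "s t"] kcos_diff[of k S "s t"] kcos_ksin_pythagoras[of k "s t"] by algebra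
  have d: "?u + ?z \<noteq> 0" using den_pos(3)[OF assms(1)] by simp
  have "(xi has_real_derivative
      (kcos k (s t) * (1 / r t) * (?u + ?z) - ?u * (kcos k (s t) * (1 / r t) + kcos k (S - s t) * (0 - 1 / r t)))
        / ((?u + ?z) * (?u + ?z))) (at t within I)"
    unfolding xi_def[abs_def] by (rule DERIV_divide[OF u' DERIV_add[OF u' z'] d])
  moreover have "cs * i * (u + z) - u * (cs * i + cz * (0 - i)) = (cs * z + u * cz) * i" for cs i u z cz :: real
    by algebra
  ultimately have "(xi has_real_derivative ksin k S * (1 / r t) / ((?u + ?z) * (?u + ?z))) (at t within I)"
    by (simp only: n)
  then show ?thesis by (simp add: power2_eq_square mult_ac)
qed

text \<open>Away from collisions the chain rule gives \<open>tau (xi t)\<close> the derivative 1,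
  because \<open>r = N / D\<close> and \<open>D = (ksin k S)\<^sup>2 / d\<^sup>2\<close> at
  \<open>xi t\<close>; continuity carries the equality across the finitely many collisions.\<close>

lemma time_xi:
  assumes "t \<in> I" shows "lambert_time (norm A) (norm B) (P t1) (kcos k S) (xi t) = t - t0"
proof -
  interpret lambert_family A B "P t1" "kcos k S" by (rule short_family)
  have n: "ksin k S > 0" using ksin_pos_short[OF S_pos] by simp
  have sq: "sqrt (2 * (norm A + norm B - 2 * P t1 * kcos k S)) = ksin k S"
    unfolding w_eq using n by simp
  have cz: "continuous_on I (\<lambda>t. ksin k (s t))" "continuous_on I (\<lambda>t. ksin k (S - s t))"
    by (rule continuous_on_compose2[OF DERIV_continuous_on[OF ksin_has_derivative] _ subset_UNIV];
        intro continuous_intros cont_s)+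
  have cxi: "continuous_on I xi"
    unfolding xi_def[abs_def] using den_pos(3) by (intro continuous_intros cz) force
  have "tau (xi t) - (t - t0) = tau (xi t0) - (t0 - t0)"
  proof (rule has_derivative_zero_unique_strong_interval[OF finite_collisions _ refl _ assms])
    show "continuous_on I (\<lambda>t. tau (xi t) - (t - t0))"
      by (intro continuous_intros continuous_on_compose2[OF continuous_on_tau cxi]) (use xi_in in auto)
    fix x assume "x \<in> I - K"
    then have x: "x \<in> I" "q x \<noteq> 0" by auto
    define d where "d = ksin k (s x) + ksin k (S - s x)"
    have d: "d \<noteq> 0" using den_pos(3)[OF x(1)] by (simp add: d_def)
    have r: "r x = N (xi x) / D (xi x)"
      using norm_point[OF xi_in[OF x(1)]] q_xi[OF x(1)] by (simp add: r_def)
    have D: "D (xi x) = (ksin k S)\<^sup>2 / d\<^sup>2" using lambert_den_xi[OF x(1)] by (simp add: d_def)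
    have rp: "r x \<noteq> 0" using r_pos[OF x(2)] by simp
    have "D (xi x) \<noteq> 0" using D d n by simp
    then have N: "N (xi x) = r x * D (xi x)" using r by simp
    have "(tau has_real_derivative ksin k S * (N (xi x) / (D (xi x))\<^sup>2)) (at (xi x) within {0..1})"
      using lambert_time_has_derivative[OF c xi_in[OF x(1)], of "norm A" "norm B" "P t1"] unfolding sq .
    then have t': "(tau has_real_derivative ksin k S * (N (xi x) / (D (xi x))\<^sup>2)) (at (xi x) within xi ` I)"
      by (rule DERIV_subset) (use xi_in in auto)
    have "((\<lambda>t. tau (xi t)) has_real_derivative
        ksin k S * (N (xi x) / (D (xi x))\<^sup>2) * (ksin k S / d\<^sup>2 * (1 / r x))) (at x within I)"
      using DERIV_image_chain[OF t' xi_deriv[OF x]] by (simp add: o_def d_def)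
    moreover have "ksin k S * (N (xi x) / (D (xi x))\<^sup>2) * (ksin k S / d\<^sup>2 * (1 / r x)) = 1"
      unfolding N unfolding D using d n rp by (simp add: field_simps power2_eq_square)
    ultimately have "((\<lambda>t. tau (xi t)) has_real_derivative 1) (at x within I)" by (simp only:)
    from DERIV_diff[OF this DERIV_diff[OF DERIV_ident DERIV_const[of t0]]]
    have "((\<lambda>t. tau (xi t) - (t - t0)) has_real_derivative 0) (at x within I)" by simp
    then show "((\<lambda>t. tau (xi t) - (t - t0)) has_derivative (\<lambda>h. 0)) (at x within I)"
      by (simp only: has_field_derivative_def lambda_zero)
  qed
  then show ?thesis by (simp add: xi_def)
qed

lemma time_end: "lambert_time (norm A) (norm B) (P t1) (kcos k S) 1 = t1 - t0"
  using time_xi[OF t1_in] ksin_pos_short[OF S_pos] by (simp add: xi_def)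

end

end

section \<open>Existence and uniqueness\<close>

text \<open>The dividing line is a half turn of \<open>z\<close>. Below it \<open>P t1\<close>
  serves as \<open>p\<close>; it is nonzero because otherwise the centre would lie on the
  segment.\<close>

lemma kepler_arc_classification:
  fixes A B :: "'a::euclidean_space"
  assumes arc: "kepler_arc_from_to 0 q t0 t1 A B"
    and nz: "A \<noteq> 0" "B \<noteq> 0" "A \<noteq> B" and seg: "0 \<notin> closed_segment A B"
  shows "multi_revolution 0 q t0 t1 \<or>
    (\<exists>p c. lambert_family A B p c \<and> lambert_time (norm A) (norm B) p c 1 = t1 - t0 \<and>
       (\<forall>t\<in>{t0..t1}. q t = lambert_family.arc A B p c t0 t))"
proof -
  have ka: "kepler_arc 0 q t0 t1" and A: "q t0 = A" and B: "q t1 = B"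
    using arc by (auto simp: kepler_arc_from_to_def)
  obtain v E e where "kepler_motion q v t0 t1 E e"
    using kepler_arc_imp_motion[OF ka] A nz by blast
  then interpret kepler_motion q v t0 t1 E e .
  show ?thesis
  proof (cases "k < 0 \<and> pi \<le> sqrt (- k) * s t1")
    case True
    then show ?thesis using long_multi_revolution A B nz by blast
  next
    case False
    then have short: "k < 0 \<Longrightarrow> sqrt (- k) * s t1 < pi" by auto
    have ends: "q t1 \<noteq> 0" "q t0 \<noteq> q t1" using A B nz by auto
    have P: "P t1 \<noteq> 0"
    proof
      assume "P t1 = 0"
      then have "norm A * norm B + A \<bullet> B = 0" using P_sq[OF t1_in] A B by (simp add: r_def)
      then show False using zero_in_segment_if_opposite nz seg by blast
    qed
    have fam: "lambert_family A B (P t1) (kcos k (s t1))"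
      using short_family[OF short ends P] A B by simp
    interpret fam: lambert_family A B "P t1" "kcos k (s t1)" by (rule fam)
    have "q t = fam.arc t0 t" if "t \<in> {t0..t1}" for t
      using fam.param_tau[OF xi_in[OF short ends P that], of t0]
        time_xi[OF short ends P that] q_xi[OF short ends P that] A B
      by (simp add: fam.arc_def)
    then show ?thesis using fam time_end[OF short ends P] A B by blast
  qed
qed

lemma lambert_family_unique:
  fixes A B :: "'a::euclidean_space"
  assumes "lambert_family A B p c" "lambert_family A B p' c'" "p < 0 \<longleftrightarrow> p' < 0"
    and "lambert_time (norm A) (norm B) p c 1 = lambert_time (norm A) (norm B) p' c' 1"
  shows "p = p' \<and> c = c'"
proof -
  interpret l: lambert_family A B p c by fact
  interpret l': lambert_family A B p' c' by fact
  have "p\<^sup>2 = p'\<^sup>2" using l.p_sq l'.p_sq by simp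
  then have p: "p = p'" using assms(3) by (auto simp: power2_eq_iff)
  have "lambertT (norm A + norm B) p c = lambertT (norm A + norm B) p c'"
    using assms(4) lambert_time_1[OF l.c] lambert_time_1[OF l'.c] p by simp
  then have "c = c'" using l.c l'.c l.nz l.p_lt l.w_pos l'.w_pos p by (intro lambertT_inj[of c c' p]) auto
  then show ?thesis using p by simp
qed

lemma unique_arcs_at_origin:
  fixes A B :: "'a::euclidean_space"
  assumes nz: "A \<noteq> 0" "B \<noteq> 0" "A \<noteq> B" and seg: "0 \<notin> closed_segment A B" and T: "T > 0"
  shows "unique_curve_on {t0..t0 + T}
           (\<lambda>q. kepler_arc_from_to 0 q t0 (t0 + T) A B \<and> direct_arc 0 q t0 (t0 + T))"
    and "unique_curve_on {t0..t0 + T}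
           (\<lambda>q. kepler_arc_from_to 0 q t0 (t0 + T) A B \<and> simple_indirect_arc 0 q t0 (t0 + T))"
proof -
  let ?I = "{t0..t0 + T}"
  \<comment> \<open>\<open>p0\<close> and \<open>- p0\<close> belong to the two square roots
    \<open>\<beta>\<close> of \<open>B\<close>, one for each kind of arc.\<close>
  define p0 where "p0 = sqrt ((norm A * norm B + A \<bullet> B) / 2)"
  have "norm A * norm B + A \<bullet> B \<noteq> 0" using zero_in_segment_if_opposite nz seg by blast
  moreover have "norm A * norm B + A \<bullet> B \<ge> 0" using norm_cauchy_schwarz[of A "- B"] by simp
  ultimately have pos: "norm A * norm B + A \<bullet> B > 0" by simp
  have p0: "p0 > 0" "2 * p0\<^sup>2 = norm A * norm B + A \<bullet> B" using pos by (simp_all add: p0_def)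
  have ex: "\<exists>c. lambert_family A B p c \<and> lambert_time (norm A) (norm B) p c 1 = T"
    if p: "p \<noteq> 0" "p\<^sup>2 = p0\<^sup>2" for p
  proof -
    interpret lambert_endpoints A B p
      by unfold_locales (use nz p p0 in auto)
    obtain c where c: "-1 < c" "norm A + norm B - 2 * p * c > 0" "lambertT (norm A + norm B) p c = T"
      using lambertT_surj[OF p(1) p_lt T] by blast
    then have "lambert_family A B p c" by unfold_locales auto
    then show ?thesis using c lambert_time_1[OF c(1)] by auto
  qed
  \<comment> \<open>Classification yields some \<open>p'\<close>, \<open>c'\<close>. The convex hull
    of \<open>q\<close> determines the sign of \<open>p'\<close>, the endpoints its square, and the
    elapsed time then \<open>c'\<close>.\<close>
  have cls: "q t = lambert_family.arc A B p c t0 t"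
    if q: "kepler_arc_from_to 0 q t0 (t0 + T) A B" "\<not> multi_revolution 0 q t0 (t0 + T)"
      and fam: "lambert_family A B p c" "lambert_time (norm A) (norm B) p c 1 = T"
      and sgn: "p < 0 \<longleftrightarrow> indirect_arc 0 q t0 (t0 + T)" and t: "t \<in> ?I" for q p c t
  proof -
    obtain p' c' where fam': "lambert_family A B p' c'" "lambert_time (norm A) (norm B) p' c' 1 = T"
      and q': "\<And>t. t \<in> ?I \<Longrightarrow> q t = lambert_family.arc A B p' c' t0 t"
      using kepler_arc_classification[OF q(1) nz seg] q(2) by auto
    interpret l: lambert_family A B p' c' by (rule fam')
    have im: "q ` ?I = l.arc t0 ` ?I" using q' by (intro image_cong) auto
    have "p' < 0 \<longleftrightarrow> indirect_arc 0 q t0 (t0 + T)"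
    proof (cases "p' < 0")
      case True
      then show ?thesis using l.arc_indirect[of t0] im fam'(2) by (simp add: indirect_arc_def)
    next
      case False
      then have "p' > 0" using l.nz by simp
      then have "0 \<notin> convex hull (q ` ?I)"
      proof (rule l.arc_direct)
        fix t assume "t \<in> ?I"
        then show "\<exists>x\<in>{0..1}. q t = lambert_point A B p' c' x"
          using q' l.param_in[of t t0] fam'(2) by (auto simp: l.arc_def)
      qed
      then show ?thesis using False by (simp add: indirect_arc_def)
    qed
    then have "p = p' \<and> c = c'"
      using lambert_family_unique[OF fam(1) fam'(1)] sgn fam(2) fam'(2) by simp
    then show ?thesis using q'[OF t] by simp
  qed
  show "unique_curve_on ?I (\<lambda>q. kepler_arc_from_to 0 q t0 (t0 + T) A B \<and> direct_arc 0 q t0 (t0 + T))"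
  proof -
    obtain c where fam: "lambert_family A B p0 c" "lambert_time (norm A) (norm B) p0 c 1 = T"
      using ex[of p0] p0 by auto
    interpret l: lambert_family A B p0 c by (rule fam)
    have "kepler_arc_from_to 0 (l.arc t0) t0 (t0 + T) A B"
      using l.kepler_arc_arc[of t0] l.arc_endpoints[of t0] fam(2) by (simp add: kepler_arc_from_to_def)
    moreover have "direct_arc 0 (l.arc t0) t0 (t0 + T)"
      unfolding direct_arc_def indirect_arc_def
    proof (rule l.arc_direct[OF p0(1)])
      fix t assume "t \<in> ?I"
      then show "\<exists>x\<in>{0..1}. l.arc t0 t = lambert_point A B p0 c x"
        using l.param_in[of t t0] fam(2) by (auto simp: l.arc_def)
    qed
    moreover have "q t = l.arc t0 t"
      if "kepler_arc_from_to 0 q t0 (t0 + T) A B" "direct_arc 0 q t0 (t0 + T)" "t \<in> ?I" for q t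
      by (rule cls[OF that(1) _ fam _ that(3)])
         (use that p0 in \<open>auto simp: direct_arc_def multi_revolution_def\<close>)
    ultimately show ?thesis unfolding unique_curve_on_def by (intro exI[of _ "l.arc t0"]) blast
  qed
  show "unique_curve_on ?I (\<lambda>q. kepler_arc_from_to 0 q t0 (t0 + T) A B \<and> simple_indirect_arc 0 q t0 (t0 + T))"
  proof -
    obtain c where fam: "lambert_family A B (- p0) c" "lambert_time (norm A) (norm B) (- p0) c 1 = T"
      using ex[of "- p0"] p0 by auto
    interpret l: lambert_family A B "- p0" c by (rule fam)
    have "kepler_arc_from_to 0 (l.arc t0) t0 (t0 + T) A B"
      using l.kepler_arc_arc[of t0] l.arc_endpoints[of t0] fam(2) by (simp add: kepler_arc_from_to_def)
    moreover have "simple_indirect_arc 0 (l.arc t0) t0 (t0 + T)"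
      using l.arc_indirect[of t0] l.arc_not_multi_revolution[of t0] fam(2) p0
      by (simp add: simple_indirect_arc_def indirect_arc_def)
    moreover have "q t = l.arc t0 t"
      if "kepler_arc_from_to 0 q t0 (t0 + T) A B" "simple_indirect_arc 0 q t0 (t0 + T)" "t \<in> ?I" for q t
      by (rule cls[OF that(1) _ fam _ that(3)])
         (use that p0 in \<open>auto simp: simple_indirect_arc_def\<close>)
    ultimately show ?thesis unfolding unique_curve_on_def by (intro exI[of _ "l.arc t0"]) blast
  qed
qed

section \<open>Reduction of an arbitrary centre to the origin\<close>

lemma kepler_arc_translate: "kepler_arc c q t0 t1 \<longleftrightarrow> kepler_arc 0 (\<lambda>t. q t - c) t0 t1"
proof -
  have 1: "continuous_on S (\<lambda>t. q t - c) \<longleftrightarrow> continuous_on S q" for S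
    using continuous_on_add[of S "\<lambda>t. q t - c" "\<lambda>_. c"] continuous_on_diff[of S q "\<lambda>_. c"] by auto
  have 2: "((\<lambda>t. q t - c) has_vector_derivative w) F \<longleftrightarrow> (q has_vector_derivative w) F" for w F
    using has_vector_derivative_add_const[of q "- c"] by simp
  have 3: "q t - c = 0 + x \<longleftrightarrow> q t = c + x" for t x by (auto simp: algebra_simps)
  show ?thesis unfolding kepler_arc_def 1 2 3 by simp
qed

lemma indirect_arc_translate: "indirect_arc c q t0 t1 \<longleftrightarrow> indirect_arc 0 (\<lambda>t. q t - c) t0 t1"
proof -
  have "(\<lambda>t. q t - c) ` {t0..t1} = (\<lambda>x. x - c) ` (q ` {t0..t1})" by (simp add: image_image)
  then have "convex hull ((\<lambda>t. q t - c) ` {t0..t1}) = (\<lambda>x. x - c) ` (convex hull (q ` {t0..t1}))"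
    using convex_hull_translation[of "- c" "q ` {t0..t1}"] by simp
  then show ?thesis unfolding indirect_arc_def by (auto simp: image_iff)
qed

lemma arc_kinds_translate:
  "kepler_arc_from_to c q t0 t1 A B \<longleftrightarrow> kepler_arc_from_to 0 (\<lambda>t. q t - c) t0 t1 (A - c) (B - c)"
  "direct_arc c q t0 t1 \<longleftrightarrow> direct_arc 0 (\<lambda>t. q t - c) t0 t1"
  "simple_indirect_arc c q t0 t1 \<longleftrightarrow> simple_indirect_arc 0 (\<lambda>t. q t - c) t0 t1"
  unfolding kepler_arc_from_to_def direct_arc_def simple_indirect_arc_def multi_revolution_def
    kepler_arc_translate[of c] indirect_arc_translate[of c] by auto

lemma unique_curve_on_translate:
  assumes "unique_curve_on S Q" shows "unique_curve_on S (\<lambda>q. Q (\<lambda>t. q t - c :: 'a::ab_group_add))"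
proof -
  obtain q where q: "Q q" "\<And>q'. Q q' \<Longrightarrow> \<forall>t\<in>S. q' t = q t"
    using assms unfolding unique_curve_on_def by blast
  have "\<forall>t\<in>S. q' t = q t + c" if "Q (\<lambda>t. q' t - c)" for q'
    using q(2)[OF that] by (auto simp: algebra_simps)
  then show ?thesis
    unfolding unique_curve_on_def using q(1) by (intro exI[of _ "\<lambda>t. q t + c"]) auto
qed

theorem mainTheorem11:
  fixes c A B :: "'a::euclidean_space" and T t0 :: real
  assumes "DIM('a) = 2 \<or> DIM('a) = 3"
    and "c \<noteq> A" and "c \<noteq> B" and "A \<noteq> B"
    and "c \<notin> closed_segment A B"
    and "T > 0"
  shows "unique_curve_on {t0..t0 + T}
           (\<lambda>q. kepler_arc_from_to c q t0 (t0 + T) A B \<and> direct_arc c q t0 (t0 + T))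
       \<and> unique_curve_on {t0..t0 + T}
           (\<lambda>q. kepler_arc_from_to c q t0 (t0 + T) A B \<and> simple_indirect_arc c q t0 (t0 + T))"
proof -
  have "closed_segment (A - c) (B - c) = (\<lambda>x. x - c) ` closed_segment A B"
    using closed_segment_translation[of "- c" A B] by (simp add: algebra_simps)
  then have seg: "0 \<notin> closed_segment (A - c) (B - c)" using assms(5) by auto
  have nz: "A - c \<noteq> 0" "B - c \<noteq> 0" "A - c \<noteq> B - c" using assms(2-4) by auto
  show ?thesis
    using unique_arcs_at_origin[OF nz seg assms(6), THEN unique_curve_on_translate[of _ _ c], of t0]
    by (simp add: arc_kinds_translate[of c])
qed

end
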